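(* Let $G = K \rtimes_\varphi \langle t\rangle$ be a finitely generated group, where $K$ is abelian, $\langle t\rangle$ is infinite cyclic and $\varphi\in\mathrm{Aut}(K)$. Let $R$ be a finite symmetric subset of $K$ such that $S=\{(r,1),(0,t^{\pm1}) : r\in R\}$ generates $G$. Let $f$ be a non-negative real function with $f(r)\to\infty$, and let $$F(r)=\{g\in S'(r) : |[g]_G\cap S(r)|\le f(r)\}.$$ Then $c(F(r))=r^{O(f(r))}$, i.e. there is a constant $C$ such that $c(F(r))\le r^{C f(r)}$ for all sufficiently large $r$.
   Context: $K$ is written additively; elements of $G$ are pairs $(k,t^m)$ with $(k,t^m)(k',t^{m'})=(k+\varphi^m(k'),t^{m+m'})$. $|g|$ is word length with respect to $S$, $S(r)=\{g:|g|=r\}$. $[g]_G$ is the conjugacy class of $g$. $S'(r)$ is the set of $g\in S(r)$ with $|g|=\min\{|h|: h\in[g]_G\}$. For $A\subseteq G$, $c(A)$ is the number of distinct conjugacy classes meeting $A$. *)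

theory Defs
  imports Complex_Main
begin

text \<open>The semidirect product G = K \<rtimes>_phi <t> is modelled on the carrier K \<times> int,
  the pair (k, m) standing for (k, t^m).\<close>

definition phi_pow :: "('k \<Rightarrow> 'k) \<Rightarrow> int \<Rightarrow> 'k \<Rightarrow> 'k" where
  "phi_pow \<phi> m = (if 0 \<le> m then \<phi> ^^ nat m else (inv \<phi>) ^^ nat (- m))"

definition sd_mult :: "('k::ab_group_add \<Rightarrow> 'k) \<Rightarrow> 'k \<times> int \<Rightarrow> 'k \<times> int \<Rightarrow> 'k \<times> int" where
  "sd_mult \<phi> x y = (fst x + phi_pow \<phi> (snd x) (fst y), snd x + snd y)"

definition sd_inv :: "('k::ab_group_add \<Rightarrow> 'k) \<Rightarrow> 'k \<times> int \<Rightarrow> 'k \<times> int" where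
  "sd_inv \<phi> x = (- phi_pow \<phi> (- snd x) (fst x), - snd x)"

definition word_eval :: "('k::ab_group_add \<Rightarrow> 'k) \<Rightarrow> ('k \<times> int) list \<Rightarrow> 'k \<times> int" where
  "word_eval \<phi> ws = foldr (sd_mult \<phi>) ws (0, 0)"

definition word_len :: "('k::ab_group_add \<Rightarrow> 'k) \<Rightarrow> ('k \<times> int) set \<Rightarrow> 'k \<times> int \<Rightarrow> nat" where
  "word_len \<phi> S g = (LEAST n. \<exists>ws. length ws = n \<and> set ws \<subseteq> S \<and> word_eval \<phi> ws = g)"

definition sphere :: "('k::ab_group_add \<Rightarrow> 'k) \<Rightarrow> ('k \<times> int) set \<Rightarrow> nat \<Rightarrow> ('k \<times> int) set" where
  "sphere \<phi> S r = {g. word_len \<phi> S g = r}"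

definition conj_class :: "('k::ab_group_add \<Rightarrow> 'k) \<Rightarrow> 'k \<times> int \<Rightarrow> ('k \<times> int) set" where
  "conj_class \<phi> g = {sd_mult \<phi> (sd_mult \<phi> h g) (sd_inv \<phi> h) | h. True}"

definition sphere' :: "('k::ab_group_add \<Rightarrow> 'k) \<Rightarrow> ('k \<times> int) set \<Rightarrow> nat \<Rightarrow> ('k \<times> int) set" where
  "sphere' \<phi> S r = {g \<in> sphere \<phi> S r. \<forall>h \<in> conj_class \<phi> g. word_len \<phi> S g \<le> word_len \<phi> S h}"

definition num_classes :: "('k::ab_group_add \<Rightarrow> 'k) \<Rightarrow> ('k \<times> int) set \<Rightarrow> nat" where
  "num_classes \<phi> A = card (conj_class \<phi> ` A)"

end

theory Submission
  imports Defs "HOL-Library.FuncSet"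
begin

text \<open>
  Write \<open>\<Delta> d = \<phi>^d - 1\<close>. A geodesic word of \<open>g \<in> F(r)\<close> is minimal in its conjugacy class, so all its
  cyclic rotations are conjugates of \<open>g\<close> on the sphere, and at most \<open>f(r)\<close> of them are distinct.
  Either the t-heights of the prefixes stay in a window of width \<open>f(r)\<close>, and then \<open>g\<close> is conjugate
  to \<open>(y, t^m)\<close> with \<open>y\<close> a combination of the \<open>\<phi>^i(\<rho>)\<close>, \<open>0 \<le> i \<le> f(r)\<close>, with coefficients at most \<open>r\<close>;
  or two rotations at heights differing by \<open>0 < |\<delta>| \<le> f(r)\<close> coincide, so that a conjugate
  \<open>(k, t^m)\<close> of \<open>g\<close> commutes with some \<open>(c, t^\<delta>)\<close>. By Bezout \<open>\<delta>\<close> may be replaced by \<open>e = gcd(\<delta>, m)\<close>;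
  then \<open>(k, t^m) = (x, 1) (c', t^e)^(m/e)\<close> with \<open>\<Delta> e x = 0\<close>, and the class depends only on
  \<open>m\<close>, \<open>e\<close>, \<open>x\<close> and the class of \<open>c'\<close> modulo \<open>\<Delta> e K\<close>, for which there are \<open>r^O(f(r))\<close> choices.

  To count the \<open>x\<close> one needs that \<open>K\<close> is a Noetherian \<open>\<int>[t, 1/t]\<close>-module: periodic elements then have
  a common period \<open>D\<close>, and \<open>ker (\<Delta> D)\<close> meets \<open>(\<Delta> D)^e K\<close> trivially for some \<open>e\<close>. Modulo
  \<open>(\<Delta> D)^e\<close> the powers \<open>\<phi>^n\<close> have polynomially growing (binomial) coefficients, so only polynomially
  many periodic elements have length at most \<open>r\<close>.
\<close>

subsection \<open>Integer multiples\<close>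

definition zmul :: "int \<Rightarrow> 'a::ab_group_add \<Rightarrow> 'a" where
  "zmul c x = (if 0 \<le> c then ((+) x ^^ nat c) 0 else ((+) (- x) ^^ nat (- c)) 0)"

lemma zmul_0 [simp]: "zmul 0 x = 0"
  by (simp add: zmul_def)

lemma zmul_add1: "zmul (c + 1) x = zmul c x + x"
proof (cases "0 \<le> c")
  case True
  then have "nat (c + 1) = Suc (nat c)" by simp
  with True show ?thesis by (simp add: zmul_def)
next
  case False
  then have "nat (- c) = Suc (nat (- (c + 1)))" by simp
  then have 1: "zmul c x = - x + ((+) (- x) ^^ nat (- (c + 1))) 0"
    using False by (simp add: zmul_def)
  show ?thesis
  proof (cases "c = -1")
    case True
    with 1 show ?thesis by simp
  next
    case False
    with \<open>\<not> 0 \<le> c\<close> 1 show ?thesis by (simp add: zmul_def)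
  qed
qed

lemma zmul_diff1: "zmul (c - 1) x = zmul c x - x"
  using zmul_add1[of "c - 1" x] by (simp add: algebra_simps)

lemma zmul_1 [simp]: "zmul 1 x = x"
  using zmul_add1[of 0 x] by simp

lemma zmul_add_left: "zmul (a + b) x = zmul a x + zmul b x"
proof (induction b rule: int_induct[of _ 0])
  case (step1 i)
  then show ?case
    using zmul_add1[of "a + i" x] zmul_add1[of i x] by (simp add: ac_simps)
next
  case (step2 i)
  then show ?case
    using zmul_diff1[of "a + i" x] by (simp add: zmul_diff1 algebra_simps)
qed simp

lemma zmul_minus_left: "zmul (- a) x = - zmul a x"
  using zmul_add_left[of a "- a" x] by (simp add: eq_neg_iff_add_eq_0 add.commute)

lemma zmul_diff_left: "zmul (a - b) x = zmul a x - zmul b x"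
  using zmul_add_left[of a "- b" x] by (simp add: zmul_minus_left)

lemma additive_zmul: "additive h \<Longrightarrow> h (zmul c x) = zmul c (h x)"
proof (induction c rule: int_induct[of _ 0])
  case base
  then show ?case by (simp add: additive.zero)
next
  case (step1 i)
  then show ?case by (simp add: zmul_add1 additive.add)
next
  case (step2 i)
  then show ?case by (simp add: zmul_diff1 additive.diff)
qed

lemma zmul_add_right: "zmul c (x + y) = zmul c x + zmul c y"
proof (induction c rule: int_induct[of _ 0])
  case (step1 i)
  then show ?case by (simp add: zmul_add1)
next
  case (step2 i)
  then show ?case by (simp add: zmul_diff1)
qed simp

lemma additive_zmul_right: "additive (zmul c)"
  by (simp add: additive_def zmul_add_right)

lemma zmul_mult: "zmul (a * b) x = zmul a (zmul b x)"
proof (induction a rule: int_induct[of _ 0])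
  case (step1 i)
  then show ?case by (simp add: zmul_add1 zmul_add_left distrib_right)
next
  case (step2 i)
  then show ?case by (simp add: zmul_diff1 zmul_diff_left left_diff_distrib)
qed simp

subsection \<open>Bounded integer combinations\<close>

text \<open>Elements are counted through their coefficient vectors: for finite \<open>I\<close>
  there are at most \<open>(2 * n + 1) ^ card I\<close> of them, which is polynomial in
  \<open>n\<close> with exponent \<open>card I\<close>.\<close>

definition comb :: "'i set \<Rightarrow> ('i \<Rightarrow> 'a::ab_group_add) \<Rightarrow> nat \<Rightarrow> 'a set" where
  "comb I v n = {(\<Sum>i\<in>I. zmul (c i) (v i)) | c. \<forall>i\<in>I. \<bar>c i\<bar> \<le> int n}"

lemma combI: "x = (\<Sum>i\<in>I. zmul (c i) (v i)) \<Longrightarrow> (\<And>i. i \<in> I \<Longrightarrow> \<bar>c i\<bar> \<le> int n) \<Longrightarrow> x \<in> comb I v n"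
  by (auto simp: comb_def)

lemma combE:
  assumes "x \<in> comb I v n"
  obtains c where "x = (\<Sum>i\<in>I. zmul (c i) (v i))" "\<And>i. i \<in> I \<Longrightarrow> \<bar>c i\<bar> \<le> int n"
  using assms by (auto simp: comb_def)

lemma comb_zero: "0 \<in> comb I v n"
  by (rule combI[where c = "\<lambda>_. 0"]) auto

lemma comb_mono: "n \<le> m \<Longrightarrow> comb I v n \<subseteq> comb I v m"
  by (fastforce simp: comb_def)

lemma comb_add:
  assumes "x \<in> comb I v n" "y \<in> comb I v m"
  shows "x + y \<in> comb I v (n + m)"
proof -
  obtain c where c: "x = (\<Sum>i\<in>I. zmul (c i) (v i))" "\<And>i. i \<in> I \<Longrightarrow> \<bar>c i\<bar> \<le> int n"
    using assms(1) by (rule combE) blast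
  obtain d where d: "y = (\<Sum>i\<in>I. zmul (d i) (v i))" "\<And>i. i \<in> I \<Longrightarrow> \<bar>d i\<bar> \<le> int m"
    using assms(2) by (rule combE) blast
  show ?thesis
  proof (rule combI)
    show "x + y = (\<Sum>i\<in>I. zmul (c i + d i) (v i))"
      by (simp add: c d zmul_add_left sum.distrib)
    show "\<bar>c i + d i\<bar> \<le> int (n + m)" if "i \<in> I" for i
      using c(2)[OF that] d(2)[OF that] by linarith
  qed
qed

lemma comb_zmul:
  assumes "x \<in> comb I v n"
  shows "zmul a x \<in> comb I v (nat \<bar>a\<bar> * n)"
proof -
  obtain c where c: "x = (\<Sum>i\<in>I. zmul (c i) (v i))" "\<And>i. i \<in> I \<Longrightarrow> \<bar>c i\<bar> \<le> int n"
    using assms(1) by (rule combE) blast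
  show ?thesis
  proof (rule combI)
    show "zmul a x = (\<Sum>i\<in>I. zmul (a * c i) (v i))"
      by (simp add: c zmul_mult additive.sum[OF additive_zmul_right])
    show "\<bar>a * c i\<bar> \<le> int (nat \<bar>a\<bar> * n)" if "i \<in> I" for i
      using c(2)[OF that] by (simp add: abs_mult mult_left_mono)
  qed
qed

lemma comb_minus:
  assumes "x \<in> comb I v n"
  shows "- x \<in> comb I v n"
  using comb_zmul[OF assms, of "-1"] by (simp add: zmul_minus_left)

lemma comb_sum:
  assumes "finite J" "\<And>j. j \<in> J \<Longrightarrow> u j \<in> comb I v n"
  shows "sum u J \<in> comb I v (card J * n)"
  using assms
proof (induction J rule: finite_induct)
  case empty
  then show ?case by (simp add: comb_zero)
next
  case (insert j J)
  then have "u j + sum u J \<in> comb I v (n + card J * n)"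
    by (intro comb_add) auto
  with insert show ?case by simp
qed

lemma comb_base:
  assumes "finite I" "i \<in> I"
  shows "v i \<in> comb I v 1"
proof (rule combI)
  have "(\<Sum>j\<in>I. zmul (if j = i then 1 else 0) (v j)) = (\<Sum>j\<in>I. if j = i then v j else 0)"
    by (intro sum.cong) auto
  then show "v i = (\<Sum>j\<in>I. zmul (if j = i then 1 else 0) (v j))"
    using assms by simp
qed auto

text \<open>Each of the \<open>card I\<close> summands is itself a combination with coefficients at
  most \<open>n * m\<close>.\<close>

lemma comb_subst:
  assumes "x \<in> comb I v n" "finite I" "\<And>i. i \<in> I \<Longrightarrow> v i \<in> comb J w m"
  shows "x \<in> comb J w (card I * (n * m))"
proof -
  obtain c where c: "x = (\<Sum>i\<in>I. zmul (c i) (v i))" "\<And>i. i \<in> I \<Longrightarrow> \<bar>c i\<bar> \<le> int n"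
    using assms(1) by (rule combE) blast
  have "zmul (c i) (v i) \<in> comb J w (n * m)" if "i \<in> I" for i
  proof -
    have "nat \<bar>c i\<bar> * m \<le> n * m"
      using c(2)[OF that] by (intro mult_right_mono) auto
    then show ?thesis
      using comb_zmul[OF assms(3)[OF that], of "c i"] comb_mono by blast
  qed
  then show ?thesis
    unfolding c(1) by (intro comb_sum assms(2))
qed

lemma comb_reindex:
  assumes "x \<in> comb I v n" "finite J" "inj_on s I" "s ` I \<subseteq> J" "\<And>i. i \<in> I \<Longrightarrow> w (s i) = v i"
  shows "x \<in> comb J w n"
proof -
  obtain c where c: "x = (\<Sum>i\<in>I. zmul (c i) (v i))" "\<And>i. i \<in> I \<Longrightarrow> \<bar>c i\<bar> \<le> int n"
    using assms(1) by (rule combE) blast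
  \<comment> \<open>Coefficients are carried along the injection \<open>s\<close>; indices off its
    image receive 0.\<close>
  define c' where "c' j = (if j \<in> s ` I then c (inv_into I s j) else 0)" for j
  show ?thesis
  proof (rule combI)
    have "(\<Sum>j\<in>J. zmul (c' j) (w j)) = (\<Sum>j\<in>s ` I. zmul (c' j) (w j))"
      using assms(2,4) by (intro sum.mono_neutral_right) (auto simp: c'_def)
    also have "\<dots> = (\<Sum>i\<in>I. zmul (c' (s i)) (w (s i)))"
      by (simp add: sum.reindex assms(3))
    also have "\<dots> = x"
      unfolding c by (intro sum.cong) (auto simp: c'_def assms)
    finally show "x = (\<Sum>j\<in>J. zmul (c' j) (w j))" by simp
    show "\<bar>c' j\<bar> \<le> int n" if "j \<in> J" for j
      using c(2) assms(3) by (auto simp: c'_def)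
  qed
qed

lemma comb_additive:
  assumes "additive h" "x \<in> comb I v n"
  shows "h x \<in> comb I (\<lambda>i. h (v i)) n"
proof -
  obtain c where c: "x = (\<Sum>i\<in>I. zmul (c i) (v i))" "\<And>i. i \<in> I \<Longrightarrow> \<bar>c i\<bar> \<le> int n"
    using assms(2) by (rule combE) blast
  show ?thesis
    by (rule combI[where c = c]) (use c assms(1) in \<open>auto simp: additive.sum additive_zmul\<close>)
qed

lemma comb_finite_card:
  assumes "finite I"
  shows "finite (comb I v n)" "card (comb I v n) \<le> (2 * n + 1) ^ card I"
proof -
  let ?C = "I \<rightarrow>\<^sub>E {- int n..int n}"
  have "comb I v n \<subseteq> (\<lambda>c. \<Sum>i\<in>I. zmul (c i) (v i)) ` ?C"
  proof
    fix x assume "x \<in> comb I v n"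
    then obtain c where c: "x = (\<Sum>i\<in>I. zmul (c i) (v i))" "\<And>i. i \<in> I \<Longrightarrow> \<bar>c i\<bar> \<le> int n"
      by (rule combE) blast
    have "restrict c I \<in> ?C" using c(2) by (fastforce simp: abs_le_iff)
    then show "x \<in> (\<lambda>c. \<Sum>i\<in>I. zmul (c i) (v i)) ` ?C"
      by (rule rev_image_eqI) (simp add: c)
  qed
  moreover have fin: "finite ?C" using assms by (simp add: finite_PiE)
  ultimately show "finite (comb I v n)" by (meson finite_surj)
  have "card (comb I v n) \<le> card ?C"
    using \<open>comb I v n \<subseteq> _\<close> fin by (meson surj_card_le)
  also have "\<dots> = (2 * n + 1) ^ card I"
    by (simp add: card_PiE assms nat_add_distrib nat_mult_distrib)
  finally show "card (comb I v n) \<le> (2 * n + 1) ^ card I" .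
qed

subsection \<open>Chains of subgroups\<close>

definition subgrp :: "'a::ab_group_add set \<Rightarrow> bool" where
  "subgrp A \<longleftrightarrow> 0 \<in> A \<and> (\<forall>x\<in>A. \<forall>y\<in>A. x - y \<in> A)"

lemma subgrp_zero: "subgrp A \<Longrightarrow> 0 \<in> A"
  and subgrp_diff: "subgrp A \<Longrightarrow> x \<in> A \<Longrightarrow> y \<in> A \<Longrightarrow> x - y \<in> A"
  by (auto simp: subgrp_def)

lemma subgrp_minus: "subgrp A \<Longrightarrow> x \<in> A \<Longrightarrow> - x \<in> A"
  using subgrp_diff[of A 0 x] by (simp add: subgrp_zero)

lemma subgrp_add: "subgrp A \<Longrightarrow> x \<in> A \<Longrightarrow> y \<in> A \<Longrightarrow> x + y \<in> A"
  using subgrp_diff[of A x "- y"] by (simp add: subgrp_minus)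

lemma subgrp_zmul: "subgrp A \<Longrightarrow> x \<in> A \<Longrightarrow> zmul c x \<in> A"
proof (induction c rule: int_induct[of _ 0])
qed (auto simp: subgrp_zero zmul_add1 zmul_diff1 intro: subgrp_add subgrp_diff)

lemma subgrp_sum: "subgrp A \<Longrightarrow> (\<And>i. i \<in> I \<Longrightarrow> u i \<in> A) \<Longrightarrow> sum u I \<in> A"
  by (induction I rule: infinite_finite_induct) (auto simp: subgrp_zero intro: subgrp_add)

lemma subgrp_range: "additive h \<Longrightarrow> subgrp (range h)"
  by (fastforce simp: subgrp_def additive.diff[symmetric] intro: range_eqI additive.zero[symmetric])

lemma subgrp_kernel: "additive h \<Longrightarrow> subgrp {x. h x = 0}"
  by (simp add: subgrp_def additive.diff additive.zero)

lemma subgrp_int_mult: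
  assumes "subgrp (A :: int set)" "d \<in> A"
  shows "d * q \<in> A"
  using assms
proof (induction q rule: int_induct[of _ 0])
qed (auto simp: subgrp_zero distrib_left right_diff_distrib intro: subgrp_add subgrp_diff)

text \<open>Division with remainder by the least positive element of \<open>A\<close>.\<close>

lemma subgrp_int_principal:
  assumes "subgrp (A :: int set)"
  obtains d where "d \<in> A" "\<And>a. a \<in> A \<Longrightarrow> d dvd a"
proof (cases "\<exists>a\<in>A. 0 < a")
  case False
  have "a = 0" if "a \<in> A" for a
    using False subgrp_minus[OF assms that] that by (metis neg_0_less_iff_less linorder_neqE_linordered_idom)
  \<comment> \<open>Without positive elements there are no negative ones, so \<open>A\<close> is
    trivial and \<open>d = 0\<close> generates it.\<close>
  then show ?thesis using that[of 0] subgrp_zero[OF assms] by auto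
next
  case True
  define P where "P n \<longleftrightarrow> 0 < n \<and> int n \<in> A" for n
  define d where "d = int (LEAST n. P n)"
  obtain a where "a \<in> A" "0 < a" using True by blast
  then have "P (nat a)" by (simp add: P_def)
  then have "P (LEAST n. P n)" by (rule LeastI)
  then have d: "d \<in> A" "0 < d" by (auto simp: d_def P_def)
  have "d dvd a" if "a \<in> A" for a
  proof (rule ccontr)
    assume "\<not> d dvd a"
    then have pos: "0 < a mod d" using d(2) by (simp add: dvd_eq_mod_eq_0 pos_mod_sign order_less_le)
    have "a mod d = a - d * (a div d)" by (simp add: minus_mult_div_eq_mod)
    then have "a mod d \<in> A" using subgrp_diff[OF assms that] subgrp_int_mult[OF assms d(1)] by metis
    with pos have "P (nat (a mod d))" by (simp add: P_def)
    then have "(LEAST n. P n) \<le> nat (a mod d)" by (rule Least_le)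
    then have "d \<le> a mod d" using pos by (simp add: d_def)
    then show False using pos_mod_bound[OF d(2), of a] by simp
  qed
  with d(1) show ?thesis using that by blast
qed

text \<open>A generator of the union already lies in some \<open>A J\<close>, and its multiples
  cover every \<open>A i\<close>.\<close>

lemma subgrp_int_chain:
  fixes A :: "nat \<Rightarrow> int set"
  assumes "\<And>i. subgrp (A i)" "\<And>i j. i \<le> j \<Longrightarrow> A i \<subseteq> A j"
  shows "\<exists>J. \<forall>i. A i \<subseteq> A J"
proof -
  have "subgrp (\<Union>i. A i)"
  proof -
    have "x - y \<in> A (max i j)" if "x \<in> A i" "y \<in> A j" for x y i j
      using assms(2)[of i "max i j"] assms(2)[of j "max i j"] that
      by (intro subgrp_diff[OF assms(1)]) auto
    then show ?thesis
      using subgrp_zero[OF assms(1)] unfolding subgrp_def by blast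
  qed
  then obtain d where d: "d \<in> (\<Union>i. A i)" "\<And>a. a \<in> (\<Union>i. A i) \<Longrightarrow> d dvd a"
    using subgrp_int_principal by blast
  then obtain J where "d \<in> A J" by blast
  then have "A i \<subseteq> A J" for i
    using d(2) subgrp_int_mult[OF assms(1)] by (fastforce elim: dvdE)
  then show ?thesis by blast
qed

subsection \<open>The group and its operators\<close>

locale automorphism =
  fixes \<phi> :: "'k::ab_group_add \<Rightarrow> 'k"
  assumes bij: "bij \<phi>"
    and add: "\<phi> (a + b) = \<phi> a + \<phi> b"
begin

abbreviation "P \<equiv> phi_pow \<phi>"

lemma inv_phi [simp]: "inv \<phi> (\<phi> x) = x" and phi_inv [simp]: "\<phi> (inv \<phi> x) = x"
  using bij by (auto simp: bij_is_inj bij_is_surj surj_f_inv_f)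

lemma P_0 [simp]: "P 0 x = x"
  by (simp add: phi_pow_def)

lemma P_add1: "P (m + 1) x = \<phi> (P m x)"
proof (cases "0 \<le> m")
  case True
  then have "nat (m + 1) = Suc (nat m)" by simp
  with True show ?thesis by (simp add: phi_pow_def)
next
  case False
  then have *: "nat (- m) = Suc (nat (- (m + 1)))" by simp
  show ?thesis
  proof (cases "m = -1")
    case True
    then show ?thesis by (simp add: phi_pow_def)
  next
    case False
    with \<open>\<not> 0 \<le> m\<close> * show ?thesis by (simp add: phi_pow_def)
  qed
qed

lemma P_diff1: "P (m - 1) x = inv \<phi> (P m x)"
  using P_add1[of "m - 1" x] by simp

lemma P_add: "P (a + b) x = P a (P b x)"
proof (induction a rule: int_induct[of _ 0])
  case (step1 i)
  then show ?case using P_add1[of "i + b" x] P_add1[of i "P b x"] by (simp add: ac_simps)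
next
  case (step2 i)
  then show ?case using P_diff1[of "i + b" x] P_diff1[of i "P b x"] by (simp add: algebra_simps)
qed simp

lemma P_minus [simp]: "P (- a) (P a x) = x" "P a (P (- a) x) = x"
  by (simp_all flip: P_add)

lemma P_1: "P 1 x = \<phi> x"
  using P_add1[of 0 x] by simp

lemma P_commute: "P a (P b x) = P b (P a x)"
  by (simp flip: P_add add: add.commute)

lemma phi_additive: "additive \<phi>"
  by (simp add: additive_def add)

lemma inv_additive: "additive (inv \<phi>)"
proof
  fix x y
  have "\<phi> (inv \<phi> x + inv \<phi> y) = x + y" by (simp add: add)
  then show "inv \<phi> (x + y) = inv \<phi> x + inv \<phi> y" by (metis inv_phi)
qed

lemma P_additive: "additive (P a)"
proof (induction a rule: int_induct[of _ 0])
  case base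
  then show ?case by (simp add: additive_def)
next
  case (step1 i)
  then show ?case by (simp add: additive_def P_add1 add)
next
  case (step2 i)
  then show ?case by (simp add: additive_def P_diff1 additive.add[OF inv_additive])
qed

lemmas P_plus = additive.add[OF P_additive]
  and P_zero [simp] = additive.zero[OF P_additive]
  and P_uminus = additive.minus[OF P_additive]
  and P_diff = additive.diff[OF P_additive]
  and P_sum = additive.sum[OF P_additive]

lemma sd_mult_assoc: "sd_mult \<phi> (sd_mult \<phi> x y) z = sd_mult \<phi> x (sd_mult \<phi> y z)"
  by (simp add: sd_mult_def P_plus P_add add.assoc)

lemma sd_mult_one [simp]: "sd_mult \<phi> (0, 0) x = x" "sd_mult \<phi> x (0, 0) = x"
  by (simp_all add: sd_mult_def)

lemma sd_mult_inv [simp]: "sd_mult \<phi> x (sd_inv \<phi> x) = (0, 0)" "sd_mult \<phi> (sd_inv \<phi> x) x = (0, 0)"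
  by (simp_all add: sd_mult_def sd_inv_def P_uminus)

lemma conj_class_eqI:
  assumes "g' = sd_mult \<phi> (sd_mult \<phi> h g) (sd_inv \<phi> h)"
  shows "conj_class \<phi> g' = conj_class \<phi> g"
proof -
  let ?m = "sd_mult \<phi>" and ?i = "sd_inv \<phi>"
  have inv_mult: "?i (?m a b) = ?m (?i b) (?i a)" for a b
    by (simp add: sd_mult_def sd_inv_def P_plus P_uminus algebra_simps flip: P_add)
  have sub: "conj_class \<phi> (?m (?m h g) (?i h)) \<subseteq> conj_class \<phi> g" for h g
  proof
    fix x assume "x \<in> conj_class \<phi> (?m (?m h g) (?i h))"
    then obtain k where "x = ?m (?m k (?m (?m h g) (?i h))) (?i k)" by (auto simp: conj_class_def)
    then have "x = ?m (?m (?m k h) g) (?i (?m k h))" by (simp only: inv_mult sd_mult_assoc)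
    then show "x \<in> conj_class \<phi> g" unfolding conj_class_def by blast
  qed
  \<comment> \<open>\<open>g\<close> is the conjugate of \<open>g'\<close> by the inverse of
    \<open>h\<close>, so \<open>sub\<close> serves both inclusions.\<close>
  have "?m (?m (?i h) g') (?i (?i h)) = ?m (?m (?m (?i h) h) g) (?m (?i h) (?i (?i h)))"
    unfolding assms by (simp only: sd_mult_assoc)
  then have "g = ?m (?m (?i h) g') (?i (?i h))" by simp
  then show ?thesis using sub assms by (metis subset_antisym)
qed

lemma conj_class_eq: "g' \<in> conj_class \<phi> g \<Longrightarrow> conj_class \<phi> g' = conj_class \<phi> g"
  by (subst (asm) conj_class_def, elim CollectE exE conjE) (rule conj_class_eqI)

lemma conj_class_shift: "conj_class \<phi> (P a k, m) = conj_class \<phi> (k, m)"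
  by (rule conj_class_eqI[of _ "(0, a)"]) (simp add: sd_mult_def sd_inv_def)

definition \<Delta> :: "int \<Rightarrow> 'k \<Rightarrow> 'k" where "\<Delta> d x = P d x - x"

text \<open>Conjugation by \<open>(h, 0)\<close>. Hence, for fixed \<open>m\<close>, the class of
  \<open>(k, m)\<close> depends only on \<open>k\<close> modulo the image of
  \<open>\<Delta> m\<close>.\<close>

lemma conj_class_translate: "conj_class \<phi> (k - \<Delta> m h, m) = conj_class \<phi> (k, m)"
  by (rule conj_class_eqI[of _ "(h, 0)"]) (simp add: sd_mult_def sd_inv_def \<Delta>_def algebra_simps P_uminus)

lemma \<Delta>_additive: "additive (\<Delta> d)"
  by (simp add: additive_def \<Delta>_def P_plus)

lemma \<Delta>_pow_additive: "additive (\<Delta> d ^^ e)"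
  by (induction e) (auto simp: additive_def additive.add[OF \<Delta>_additive])

lemma \<Delta>_P: "\<Delta> d (P a x) = P a (\<Delta> d x)"
  by (simp add: \<Delta>_def P_diff P_commute)

lemma \<Delta>_pow_P: "(\<Delta> d ^^ e) (P a x) = P a ((\<Delta> d ^^ e) x)"
  by (induction e) (auto simp: \<Delta>_P)

lemma \<Delta>_add: "\<Delta> (a + b) x = P b (\<Delta> a x) + \<Delta> b x"
  by (simp add: \<Delta>_def P_diff P_add P_commute)

definition geo :: "int \<Rightarrow> nat \<Rightarrow> 'k \<Rightarrow> 'k" where
  "geo d q x = (\<Sum>l<q. P (d * int l) x)"

text \<open>\<open>Q a d\<close> plays the role of \<open>(\<phi>^(a d) - 1) / (\<phi>^d - 1)\<close>, for either sign of \<open>a\<close> and \<open>d\<close>.\<close>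

definition Q :: "int \<Rightarrow> int \<Rightarrow> 'k \<Rightarrow> 'k" where
  "Q a d x = (if 0 \<le> a then geo d (nat a) x else - P (a * d) (geo d (nat (- a)) x))"

lemma geo_additive: "additive (geo d q)"
  by (simp add: additive_def geo_def P_plus sum.distrib)

lemma Q_additive: "additive (Q a d)"
  by (simp add: additive_def Q_def additive.add[OF geo_additive] P_plus)

lemma geo_P: "geo d q (P b x) = P b (geo d q x)"
  by (simp add: geo_def P_sum P_commute)

lemma Q_P: "Q a d (P b x) = P b (Q a d x)"
  by (simp add: Q_def geo_P P_commute P_uminus)

lemma \<Delta>_geo: "\<Delta> d (geo d q x) = \<Delta> (int q * d) x"
proof (induction q)
  case 0
  then show ?case by (simp add: geo_def \<Delta>_def)
next
  case (Suc q)
  have "geo d (Suc q) x = geo d q x + P (d * int q) x" by (simp add: geo_def)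
  then show ?case
    using Suc by (simp add: additive.add[OF \<Delta>_additive] \<Delta>_def P_plus algebra_simps flip: P_add)
qed

lemma \<Delta>_Q: "\<Delta> d (Q a d x) = \<Delta> (a * d) x"
proof (cases "0 \<le> a")
  case True
  then show ?thesis by (simp add: Q_def \<Delta>_geo)
next
  case False
  then have "\<Delta> d (Q a d x) = - P (a * d) (\<Delta> (- (a * d)) x)"
    by (simp add: Q_def additive.minus[OF \<Delta>_additive] \<Delta>_P \<Delta>_geo)
  then show ?thesis by (simp add: \<Delta>_def P_diff)
qed

lemma Q_\<Delta>: "Q a d (\<Delta> d x) = \<Delta> (a * d) x"
  by (subst \<Delta>_Q[symmetric]) (simp add: \<Delta>_def additive.diff[OF Q_additive] Q_P)

subsection \<open>Chain condition for invariant subgroups\<close>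

text \<open>The chains consist of subgroups of all of \<open>K\<close> and are compared on
  \<open>L\<close> only. Invariance is under \<open>\<phi>\<close> but not its inverse, so this is a
  condition over polynomials in \<open>t\<close>, where a notion of degree is available.\<close>

definition noetherian :: "'k set \<Rightarrow> bool" where
  "noetherian L \<longleftrightarrow> (\<forall>N. (\<forall>i::nat. subgrp (N i) \<and> \<phi> ` N i \<subseteq> N i) \<longrightarrow> (\<forall>i j. i \<le> j \<longrightarrow> N i \<subseteq> N j) \<longrightarrow>
     (\<exists>J. \<forall>i. N i \<inter> L \<subseteq> N J))"

context
  fixes L :: "'k set" and \<rho> :: 'k
  assumes L: "subgrp L" "\<phi> ` L \<subseteq> L"
begin

text \<open>\<open>W n\<close> is \<open>L\<close> plus the integer combinations of
  \<open>\<phi>^i \<rho>\<close> with \<open>i < n\<close>: the elements of degree below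
  \<open>n\<close> over \<open>L\<close>.\<close>

fun W :: "nat \<Rightarrow> 'k set" where
  "W 0 = L"
| "W (Suc n) = {zmul a ((\<phi> ^^ n) \<rho>) + w | a w. w \<in> W n}"

lemma W_subgrp: "subgrp (W n)"
proof (induction n)
  case 0
  show ?case by (simp add: L)
next
  case (Suc n)
  have 1: "0 \<in> W (Suc n)"
    using subgrp_zero[OF Suc] by (auto intro!: exI[of _ "0::int"])
  have 2: "zmul a v + w - (zmul a' v + w') = zmul (a - a') v + (w - w')" for a a' w w' and v :: 'k
    by (simp add: zmul_diff_left)
  show ?case
    unfolding subgrp_def
  proof (intro conjI ballI 1)
    fix x y assume "x \<in> W (Suc n)" "y \<in> W (Suc n)"
    then show "x - y \<in> W (Suc n)"
      using subgrp_diff[OF Suc] by (auto simp: 2) blast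
  qed
qed

lemma W_Suc: "W n \<subseteq> W (Suc n)"
  by (auto intro!: exI[of _ "0::int"])

lemma W_phi: "w \<in> W n \<Longrightarrow> \<phi> w \<in> W (Suc n)"
proof (induction n arbitrary: w)
  case 0
  then show ?case using L(2) by (auto intro!: exI[of _ "0::int"])
next
  case (Suc n)
  then obtain a v where v: "w = zmul a ((\<phi> ^^ n) \<rho>) + v" "v \<in> W n" by auto
  have "\<phi> w = zmul a ((\<phi> ^^ Suc n) \<rho>) + \<phi> v"
    by (simp add: v add additive_zmul[OF phi_additive])
  with Suc.IH[OF v(2)] show ?case unfolding W.simps(2)[of "Suc n"] by blast
qed

text \<open>As in Hilbert's basis theorem, with \<open>\<Lambda> n i\<close> the ideal of leading coefficients in degree \<open>n\<close>
  of the elements of \<open>N i\<close>; degrees are measured relative to \<open>L\<close>, so no polynomials are needed.\<close>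

lemma W_noetherian:
  assumes "noetherian L"
  shows "noetherian (\<Union>n. W n)"
  unfolding noetherian_def
proof (intro allI impI)
  fix N :: "nat \<Rightarrow> 'k set"
  assume N: "\<forall>i. subgrp (N i) \<and> \<phi> ` N i \<subseteq> N i" and mono: "\<forall>i j. i \<le> j \<longrightarrow> N i \<subseteq> N j"
  obtain J0 where J0: "\<And>i. N i \<inter> L \<subseteq> N J0"
    using assms N mono unfolding noetherian_def by blast
  define \<Lambda> where "\<Lambda> n i = {a. \<exists>w\<in>W n. zmul a ((\<phi> ^^ n) \<rho>) + w \<in> N i}" for n i
  have \<Lambda>_subgrp: "subgrp (\<Lambda> n i)" for n i
    unfolding subgrp_def
  proof (intro conjI ballI)
    show "0 \<in> \<Lambda> n i"
      using N subgrp_zero W_subgrp by (auto simp: \<Lambda>_def intro!: bexI[of _ 0])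
    fix a b assume "a \<in> \<Lambda> n i" "b \<in> \<Lambda> n i"
    then obtain v w where "v \<in> W n" "zmul a ((\<phi> ^^ n) \<rho>) + v \<in> N i"
        "w \<in> W n" "zmul b ((\<phi> ^^ n) \<rho>) + w \<in> N i"
      by (auto simp: \<Lambda>_def)
    then have "v - w \<in> W n" "(zmul a ((\<phi> ^^ n) \<rho>) + v) - (zmul b ((\<phi> ^^ n) \<rho>) + w) \<in> N i"
      using N W_subgrp by (auto intro: subgrp_diff)
    moreover have "(zmul a ((\<phi> ^^ n) \<rho>) + v) - (zmul b ((\<phi> ^^ n) \<rho>) + w) = zmul (a - b) ((\<phi> ^^ n) \<rho>) + (v - w)"
      by (simp add: zmul_diff_left)
    ultimately show "a - b \<in> \<Lambda> n i" by (auto simp: \<Lambda>_def)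
  qed
  have \<Lambda>_mono_i: "\<Lambda> n i \<subseteq> \<Lambda> n j" if "i \<le> j" for n i j
    using mono that by (fastforce simp: \<Lambda>_def)
  have \<Lambda>_Suc: "\<Lambda> n i \<subseteq> \<Lambda> (Suc n) i" for n i
  proof
    fix a assume "a \<in> \<Lambda> n i"
    then obtain w where w: "w \<in> W n" "zmul a ((\<phi> ^^ n) \<rho>) + w \<in> N i" by (auto simp: \<Lambda>_def)
    then have "\<phi> (zmul a ((\<phi> ^^ n) \<rho>) + w) \<in> N i" using N by blast
    then have "zmul a ((\<phi> ^^ Suc n) \<rho>) + \<phi> w \<in> N i"
      by (simp add: add additive_zmul[OF phi_additive])
    with W_phi[OF w(1)] show "a \<in> \<Lambda> (Suc n) i" unfolding \<Lambda>_def by blast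
  qed
  have \<Lambda>_mono: "\<Lambda> n i \<subseteq> \<Lambda> m j" if "n \<le> m" "i \<le> j" for n m i j
    using lift_Suc_mono_le[of "\<lambda>n. \<Lambda> n i", OF \<Lambda>_Suc that(1)] \<Lambda>_mono_i[OF that(2)] by blast
  \<comment> \<open>The diagonal chain grows in degree and stage at once, so its limit
    \<open>\<Lambda> D D\<close> contains every \<open>\<Lambda> n i\<close>.\<close>
  obtain D where D: "\<And>i. \<Lambda> i i \<subseteq> \<Lambda> D D"
    using subgrp_int_chain[of "\<lambda>i. \<Lambda> i i"] \<Lambda>_subgrp \<Lambda>_mono by metis
  have "\<exists>J. \<forall>i. \<Lambda> n i \<subseteq> \<Lambda> n J" for n
    using subgrp_int_chain[of "\<Lambda> n"] \<Lambda>_subgrp \<Lambda>_mono_i by metis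
  then obtain j where j: "\<And>n i. \<Lambda> n i \<subseteq> \<Lambda> n (j n)" by metis
  \<comment> \<open>\<open>J\<close> serves the part inside \<open>L\<close> (stage
    \<open>J0\<close>), all large degrees (stage \<open>D\<close>), and each of the finitely many
    degrees up to \<open>D\<close> (stage \<open>j n\<close>).\<close>
  define J where "J = Max ({J0, D} \<union> j ` {..D})"
  have "x \<le> J" if "x \<in> {J0, D} \<union> j ` {..D}" for x
    unfolding J_def using that by (intro Max_ge) auto
  then have J_ge: "J0 \<le> J" "D \<le> J" "\<And>n. n \<le> D \<Longrightarrow> j n \<le> J" by auto
  have \<Lambda>_J: "\<Lambda> n i \<subseteq> \<Lambda> n J" for n i
  proof (cases "n \<le> D")
    case True
    then show ?thesis using j[of n i] \<Lambda>_mono_i[OF J_ge(3)] by blast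
  next
    case False
    have "\<Lambda> n i \<subseteq> \<Lambda> (max n i) (max n i)" by (rule \<Lambda>_mono) auto
    also have "\<dots> \<subseteq> \<Lambda> D D" by (rule D)
    also have "\<dots> \<subseteq> \<Lambda> n J" using False J_ge by (intro \<Lambda>_mono) auto
    finally show ?thesis .
  qed
  \<comment> \<open>Induction on the degree: subtracting an element of \<open>N J\<close> with the
    same leading coefficient leaves an element of \<open>N i\<close> of smaller degree.\<close>
  have "N i \<inter> W n \<subseteq> N J" if "J \<le> i" for n i
  proof (induction n)
    case 0
    then show ?case using J0[of i] mono J_ge(1) by auto
  next
    case (Suc n)
    show ?case
    proof
      fix x assume x: "x \<in> N i \<inter> W (Suc n)"
      then obtain a w where w: "x = zmul a ((\<phi> ^^ n) \<rho>) + w" "w \<in> W n" by auto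
      with x have "a \<in> \<Lambda> n i" by (auto simp: \<Lambda>_def)
      then have "a \<in> \<Lambda> n J" using \<Lambda>_J by blast
      then obtain v where v: "v \<in> W n" "zmul a ((\<phi> ^^ n) \<rho>) + v \<in> N J" by (auto simp: \<Lambda>_def)
      then have "zmul a ((\<phi> ^^ n) \<rho>) + v \<in> N i" using mono that by blast
      then have "x - (zmul a ((\<phi> ^^ n) \<rho>) + v) \<in> N i"
        using x N by (intro subgrp_diff) auto
      then have "w - v \<in> N i" by (simp add: w)
      moreover have "w - v \<in> W n" using v(1) w(2) W_subgrp by (auto intro: subgrp_diff)
      ultimately have wv: "w - v \<in> N J" using Suc by blast
      have "(w - v) + (zmul a ((\<phi> ^^ n) \<rho>) + v) \<in> N J"
        by (rule subgrp_add[OF _ wv v(2)]) (use N in blast)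
      then show "x \<in> N J" by (simp add: w add.commute)
    qed
  qed
  then have "N i \<inter> (\<Union>n. W n) \<subseteq> N J" for i
  proof -
    have "N i \<subseteq> N (max i J)" using mono by auto
    then show ?thesis using \<open>\<And>n i. J \<le> i \<Longrightarrow> N i \<inter> W n \<subseteq> N J\<close>[of "max i J"] by auto
  qed
  then show "\<exists>J. \<forall>i. N i \<inter> (\<Union>n. W n) \<subseteq> N J" by blast
qed

text \<open>One step of Hilbert's basis theorem: \<open>L'\<close> is the union of the
  \<open>W n\<close>, the smallest \<open>\<phi>\<close>-invariant subgroup containing
  \<open>L\<close> and \<open>\<rho>\<close>.\<close>

lemma noetherian_insert:
  assumes "noetherian L"
  obtains L' where "subgrp L'" "\<phi> ` L' \<subseteq> L'" "insert \<rho> L \<subseteq> L'" "noetherian L'"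
proof
  have mono: "W n \<subseteq> W m" if "n \<le> m" for n m
    using lift_Suc_mono_le[of W, OF W_Suc that] .
  have "x - y \<in> W (max n m)" if "x \<in> W n" "y \<in> W m" for x y n m
    using that mono[of n "max n m"] mono[of m "max n m"] by (intro subgrp_diff W_subgrp) auto
  then show "subgrp (\<Union>n. W n)"
    using subgrp_zero[OF W_subgrp] unfolding subgrp_def by blast
  show "\<phi> ` (\<Union>n. W n) \<subseteq> (\<Union>n. W n)" using W_phi by blast
  have "\<rho> \<in> W 1"
    using subgrp_zero[OF L(1)] by (auto intro!: exI[of _ "1::int"])
  moreover have "L \<subseteq> W 0" by simp
  ultimately show "insert \<rho> L \<subseteq> (\<Union>n. W n)" by blast
  show "noetherian (\<Union>n. W n)" by (rule W_noetherian[OF assms])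
qed

end

text \<open>The generators are adjoined one at a time, starting from the trivial subgroup.\<close>

lemma noetherian_span:
  assumes "finite R"
  obtains L where "subgrp L" "\<phi> ` L \<subseteq> L" "R \<subseteq> L" "noetherian L"
  using assms
proof (induction R arbitrary: thesis rule: finite_induct)
  case empty
  show ?case
  proof (rule empty)
    show "noetherian {0}" unfolding noetherian_def by (auto dest: subgrp_zero)
  qed (auto simp: subgrp_def additive.zero[OF phi_additive])
next
  case (insert x R)
  obtain L where L: "subgrp L" "\<phi> ` L \<subseteq> L" "R \<subseteq> L" "noetherian L"
    using insert.IH by blast
  obtain L' where "subgrp L'" "\<phi> ` L' \<subseteq> L'" "insert x L \<subseteq> L'" "noetherian L'"
    using noetherian_insert[OF L(1,2,4), where \<rho> = x] by blast
  with L(3) show ?case by (intro insert.prems[of L']) auto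
qed

end

text \<open>The coefficient of \<open>\<delta>\<close> is reduced modulo
  \<open>\<bar>m\<bar>\<close> and the other one compensates; its bound comes from estimating
  \<open>b * m = gcd \<delta> m - a * \<delta>\<close>. The \<open>+ 1\<close> accommodates
  \<open>m = 0\<close>, where \<open>a = sgn \<delta>\<close>.\<close>

lemma bezout_bounded:
  fixes \<delta> m :: int
  assumes "\<delta> \<noteq> 0"
  obtains a b where "a * \<delta> + b * m = gcd \<delta> m" "\<bar>a\<bar> \<le> \<bar>m\<bar> + 1" "\<bar>b\<bar> \<le> \<bar>\<delta>\<bar>"
proof (cases "m = 0")
  case True
  have "sgn \<delta> * \<delta> + 0 * m = gcd \<delta> m" "\<bar>sgn \<delta>\<bar> \<le> \<bar>m\<bar> + 1" "\<bar>0\<bar> \<le> \<bar>\<delta>\<bar>"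
    by (auto simp: True sgn_if)
  then show ?thesis by (rule that)
next
  case False
  obtain u v where uv: "u * \<delta> + v * m = gcd \<delta> m" using bezout_int by blast
  define a where "a = u mod \<bar>m\<bar>"
  define b where "b = v + sgn m * (u div \<bar>m\<bar>) * \<delta>"
  have a: "0 \<le> a" "a \<le> \<bar>m\<bar> - 1" using False by (auto simp: a_def)
  have "sgn m * m = \<bar>m\<bar>" by (simp add: abs_sgn mult.commute)
  then have "a = u - (sgn m * m) * (u div \<bar>m\<bar>)"
    unfolding a_def by (simp only: minus_mult_div_eq_mod)
  then have eq: "a * \<delta> + b * m = gcd \<delta> m"
    using uv unfolding b_def by (simp only:) (simp add: algebra_simps)
  have "gcd \<delta> m \<le> \<bar>\<delta>\<bar>" using assms using gcd_le1_int[of "\<bar>\<delta>\<bar>" m] by simp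
  then have "\<bar>gcd \<delta> m - a * \<delta>\<bar> \<le> \<bar>\<delta>\<bar> + \<bar>a * \<delta>\<bar>"
    by (intro order.trans[OF abs_triangle_ineq4] add_right_mono) simp
  also have "\<dots> = (a + 1) * \<bar>\<delta>\<bar>" using a by (simp add: abs_mult algebra_simps)
  also have "\<dots> \<le> \<bar>m\<bar> * \<bar>\<delta>\<bar>" using a by (intro mult_right_mono) auto
  finally have "\<bar>b * m\<bar> \<le> \<bar>m\<bar> * \<bar>\<delta>\<bar>" using eq by (simp add: algebra_simps)
  then have "\<bar>b\<bar> \<le> \<bar>\<delta>\<bar>" using False by (simp add: abs_mult mult.commute)
  then show ?thesis using that[OF eq] a by simp
qed

section \<open>Words and bounded combinations of translates of \<open>R\<close>\<close>

locale generated = automorphism \<phi> for \<phi> :: "'k::ab_group_add \<Rightarrow> 'k" +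
  fixes R :: "'k set"
  assumes fin_R: "finite R"
    and gen: "\<exists>ws. set ws \<subseteq> (\<lambda>r. (r, 0)) ` R \<union> {(0, 1), (0, -1)} \<and> word_eval \<phi> ws = g"
begin

abbreviation S :: "('k \<times> int) set" where "S \<equiv> (\<lambda>r. (r, 0)) ` R \<union> {(0, 1), (0, -1)}"

definition box :: "int set \<Rightarrow> nat \<Rightarrow> 'k set" where
  "box I n = comb (R \<times> I) (\<lambda>(\<rho>, i). P i \<rho>) n"

text \<open>Replaces the ball of radius \<open>n\<close> in \<open>K\<close>: it contains the
  \<open>K\<close>-component of every word of length at most \<open>n\<close>, and its growth under
  \<open>P\<close>, sums and \<open>Q\<close> has explicit bounds.\<close>

definition B :: "nat \<Rightarrow> 'k set" where "B n = box {- int n..int n} n"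

lemma box_mono:
  assumes "x \<in> box I n" "I \<subseteq> J" "finite J" "n \<le> m"
  shows "x \<in> box J m"
proof -
  have "x \<in> box J n"
    using assms(1) unfolding box_def
    by (rule comb_reindex[where s = id]) (use assms fin_R in auto)
  then show ?thesis using comb_mono[OF assms(4)] unfolding box_def by blast
qed

lemma box_P:
  assumes "x \<in> box I n" "(+) a ` I \<subseteq> J" "finite J"
  shows "P a x \<in> box J n"
proof -
  have "P a x \<in> comb (R \<times> I) (\<lambda>p. P a ((\<lambda>(\<rho>, i). P i \<rho>) p)) n"
    using assms(1) unfolding box_def by (rule comb_additive[OF P_additive])
  then show ?thesis
    unfolding box_def
    by (rule comb_reindex[where s = "\<lambda>(\<rho>, i). (\<rho>, a + i)"])
      (use assms fin_R in \<open>auto simp: P_add inj_on_def\<close>)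
qed

lemma B_mono: "x \<in> B n \<Longrightarrow> n \<le> m \<Longrightarrow> x \<in> B m"
  unfolding B_def by (rule box_mono) auto

lemma B_add:
  assumes "x \<in> B n" "y \<in> B m"
  shows "x + y \<in> B (n + m)"
proof -
  let ?J = "{- int (n + m)..int (n + m)}"
  have "x \<in> box ?J n" using assms(1) unfolding B_def by (rule box_mono) auto
  moreover have "y \<in> box ?J m" using assms(2) unfolding B_def by (rule box_mono) auto
  ultimately show ?thesis unfolding B_def box_def by (rule comb_add)
qed

lemma B_uminus: "x \<in> B n \<Longrightarrow> - x \<in> B n"
  unfolding B_def box_def by (rule comb_minus)

lemma B_diff: "x \<in> B n \<Longrightarrow> y \<in> B m \<Longrightarrow> x - y \<in> B (n + m)"
  using B_add[OF _ B_uminus] by fastforce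

lemma B_P:
  assumes "x \<in> B n"
  shows "P a x \<in> B (n + nat \<bar>a\<bar>)"
proof -
  let ?J = "{- int (n + nat \<bar>a\<bar>)..int (n + nat \<bar>a\<bar>)}"
  have "P a x \<in> box ?J n"
    using assms unfolding B_def by (rule box_P) auto
  then show ?thesis unfolding B_def by (rule box_mono) auto
qed

lemma B_sum: "finite J \<Longrightarrow> (\<And>j. j \<in> J \<Longrightarrow> u j \<in> B n) \<Longrightarrow> sum u J \<in> B (card J * n)"
proof (induction J rule: finite_induct)
  case empty
  then show ?case by (simp add: comb_zero B_def box_def)
next
  case (insert j J)
  then have "u j + sum u J \<in> B (n + card J * n)"
    by (intro B_add) auto
  with insert show ?case by simp
qed

lemma B_geo:
  assumes "x \<in> B n"
  shows "geo d q x \<in> B (q * (n + nat \<bar>d\<bar> * q))"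
proof -
  have "P (d * int l) x \<in> B (n + nat \<bar>d\<bar> * q)" if "l < q" for l
    by (rule B_mono[OF B_P[OF assms]]) (use that in \<open>simp add: abs_mult nat_mult_distrib\<close>)
  then show ?thesis
    using B_sum[of "{..<q}"] by (simp add: geo_def)
qed

text \<open>For negative \<open>a\<close> the definition of \<open>Q\<close> has an extra shift
  \<open>P (a * d)\<close>; the last \<open>z * z\<close> pays for it.\<close>

lemma B_Q:
  assumes "x \<in> B n" "nat \<bar>a\<bar> \<le> z" "nat \<bar>d\<bar> \<le> z"
  shows "Q a d x \<in> B (z * (n + z * z) + z * z)"
proof (cases "0 \<le> a")
  case True
  have "nat a * (n + nat \<bar>d\<bar> * nat a) \<le> z * (n + z * z)"
    using assms True by (intro mult_mono add_mono) auto
  then have "nat a * (n + nat \<bar>d\<bar> * nat a) \<le> z * (n + z * z) + z * z" by simp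
  with B_geo[OF assms(1)] True show ?thesis
    unfolding Q_def by (auto intro: B_mono)
next
  case False
  then have a: "nat (- a) \<le> z" using assms by simp
  have "nat (- a) * (n + nat \<bar>d\<bar> * nat (- a)) + nat \<bar>a * d\<bar> \<le> z * (n + z * z) + z * z"
    using assms a by (intro add_mono mult_mono) (simp_all add: abs_mult nat_mult_distrib mult_mono)
  then have "P (a * d) (geo d (nat (- a)) x) \<in> B (z * (n + z * z) + z * z)"
    by (rule B_mono[OF B_P[OF B_geo[OF assms(1)]]])
  with False show ?thesis
    unfolding Q_def by (auto intro: B_uminus)
qed

lemma word_eval_append: "word_eval \<phi> (us @ vs) = sd_mult \<phi> (word_eval \<phi> us) (word_eval \<phi> vs)"
  by (induction us) (auto simp: word_eval_def sd_mult_assoc)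

lemma word_eval_Nil [simp]: "word_eval \<phi> [] = (0, 0)"
  and word_eval_single [simp]: "word_eval \<phi> [s] = s"
  by (auto simp: word_eval_def)

lemma snd_word_eval_append: "snd (word_eval \<phi> (us @ vs)) = snd (word_eval \<phi> us) + snd (word_eval \<phi> vs)"
  by (simp add: word_eval_append sd_mult_def)

text \<open>Reading from left to right, a letter \<open>(\<rho>, 0)\<close> met at height
  \<open>i\<close> adds \<open>P i \<rho>\<close>, while a letter \<open>t\<close> or its inverse
  only moves the height; so no coefficient exceeds the length.\<close>

lemma word_box:
  assumes "set ws \<subseteq> S" "\<And>i. i \<le> length ws \<Longrightarrow> snd (word_eval \<phi> (take i ws)) \<in> I" "finite I"
  shows "fst (word_eval \<phi> ws) \<in> box I (length ws)"
  using assms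
proof (induction ws rule: rev_induct)
  case Nil
  then show ?case by (simp add: box_def comb_zero)
next
  case (snoc s ws)
  let ?h = "snd (word_eval \<phi> ws)"
  have "snd (word_eval \<phi> (take i ws)) \<in> I" if "i \<le> length ws" for i
    using snoc.prems(2)[of i] that by simp
  then have IH: "fst (word_eval \<phi> ws) \<in> box I (length ws)"
    using snoc by auto
  have h: "?h \<in> I" using snoc.prems(2)[of "length ws"] by simp
  have "P ?h (fst s) \<in> box I 1"
  proof (cases "fst s \<in> R")
    case True
    then show ?thesis
      using comb_base[of "R \<times> I" "(fst s, ?h)" "\<lambda>(\<rho>, i). P i \<rho>"] h snoc.prems(3) fin_R
      by (simp add: box_def)
  next
    case False
    then have "fst s = 0" using snoc.prems(1) by auto
    then show ?thesis by (simp add: box_def comb_zero)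
  qed
  with IH have "fst (word_eval \<phi> ws) + P ?h (fst s) \<in> box I (length ws + 1)"
    unfolding box_def by (rule comb_add)
  then show ?case by (simp add: word_eval_append sd_mult_def)
qed

lemma snd_word_le: "set ws \<subseteq> S \<Longrightarrow> \<bar>snd (word_eval \<phi> ws)\<bar> \<le> int (length ws)"
proof (induction ws rule: rev_induct)
  case (snoc s ws)
  then have "\<bar>snd s\<bar> \<le> 1" "\<bar>snd (word_eval \<phi> ws)\<bar> \<le> int (length ws)" by auto
  then show ?case by (simp add: snd_word_eval_append)
qed simp

lemma word_B:
  assumes "set ws \<subseteq> S"
  shows "fst (word_eval \<phi> ws) \<in> B (length ws)"
  unfolding B_def
proof (rule word_box[OF assms])
  fix i assume "i \<le> length ws"
  then show "snd (word_eval \<phi> (take i ws)) \<in> {- int (length ws)..int (length ws)}"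
    using snd_word_le[of "take i ws"] order_trans[OF set_take_subset[of i ws] assms]
    by (simp add: abs_le_iff)
qed simp

lemma ex_B: "\<exists>n. x \<in> B n"
  using gen[of "(x, 0)"] word_B by (metis fst_conv)

text \<open>Passes from polynomials to Laurent polynomials. A sufficiently high power of
  \<open>\<phi>\<close> makes all exponents of a given element non-negative and so moves it into
  \<open>L\<close>; once it is in \<open>N J\<close>, the inverse power moves it back.\<close>

lemma ascending_chain:
  fixes N :: "nat \<Rightarrow> 'k set"
  assumes "\<And>i. subgrp (N i)" "\<And>i x a. x \<in> N i \<Longrightarrow> P a x \<in> N i" "\<And>i j. i \<le> j \<Longrightarrow> N i \<subseteq> N j"
  obtains J where "\<And>i. N i \<subseteq> N J"
proof -
  obtain L where L: "subgrp L" "\<phi> ` L \<subseteq> L" "R \<subseteq> L" "noetherian L"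
    using noetherian_span[OF fin_R] by blast
  have "\<phi> ` N i \<subseteq> N i" for i using assms(2)[of _ i 1] by (auto simp: P_1)
  then obtain J where J: "\<And>i. N i \<inter> L \<subseteq> N J"
    using L(4) assms(1,3) unfolding noetherian_def by (metis (no_types, lifting))
  have PL: "P (int i) \<rho> \<in> L" if "\<rho> \<in> L" for i \<rho>
  proof (induction i)
    case (Suc i)
    have "P (int (Suc i)) \<rho> = \<phi> (P (int i) \<rho>)" using P_add1[of "int i" \<rho>] by (simp add: add.commute)
    with Suc L(2) show ?case by auto
  qed (use that in simp)
  have "x \<in> N J" if x: "x \<in> N i" for i x
  proof -
    obtain n where "x \<in> B n" using ex_B by blast
    then have "P (int n) x \<in> box {0..2 * int n} n" unfolding B_def by (rule box_P) auto
    then obtain c where "P (int n) x = (\<Sum>p\<in>R \<times> {0..2 * int n}. zmul (c p) (case p of (\<rho>, i) \<Rightarrow> P i \<rho>))"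
      unfolding box_def by (rule combE) blast
    also have "\<dots> \<in> L"
    proof (intro subgrp_sum subgrp_zmul L(1))
      fix p assume "p \<in> R \<times> {0..2 * int n}"
      then show "(case p of (\<rho>, i) \<Rightarrow> P i \<rho>) \<in> L"
        using L(3) PL[of "fst p" "nat (snd p)"] by auto
    qed
    finally have "P (int n) x \<in> N J" using J assms(2)[OF x] by blast
    then have "P (- int n) (P (int n) x) \<in> N J" by (rule assms(2))
    then show ?thesis by simp
  qed
  then show ?thesis using that by blast
qed

section \<open>Periodic elements: a common period and a polynomial bound on their number\<close>

lemma \<Delta>_mult_eq_0: "\<Delta> d x = 0 \<Longrightarrow> \<Delta> (a * d) x = 0"
  by (simp add: additive.zero[OF Q_additive] flip: Q_\<Delta>)

text \<open>The chain condition for the kernels of \<open>\<Delta> (int (fact i))\<close>. With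
  factorials the kernels ascend by divisibility, and every nonzero \<open>d\<close> divides one of
  them.\<close>

lemma uniform_period:
  obtains D :: nat where "1 \<le> D" "\<And>d x. d \<noteq> 0 \<Longrightarrow> \<Delta> d x = 0 \<Longrightarrow> \<Delta> (int D) x = 0"
proof -
  define N where "N i = {x. \<Delta> (int (fact i)) x = 0}" for i :: nat
  have mono: "N i \<subseteq> N j" if "i \<le> j" for i j
  proof -
    have "(fact i :: nat) dvd fact j" using that by (rule fact_dvd)
    then obtain q where "(fact j :: nat) = q * fact i" by (metis dvdE mult.commute)
    then have "int (fact j) = int q * int (fact i)" by (metis of_nat_mult)
    then show ?thesis using \<Delta>_mult_eq_0 by (auto simp: N_def)
  qed
  have sub: "subgrp (N i)" for i unfolding N_def by (rule subgrp_kernel[OF \<Delta>_additive])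
  have inv: "P a x \<in> N i" if "x \<in> N i" for i x a using that by (simp add: N_def \<Delta>_P)
  obtain J where J: "\<And>i. N i \<subseteq> N J"
    using ascending_chain[of N, OF sub inv mono] by blast
  have "\<Delta> (int (fact J)) x = 0" if "d \<noteq> 0" "\<Delta> d x = 0" for d x
  proof -
    have "nat \<bar>d\<bar> dvd fact (nat \<bar>d\<bar>)" using that(1) by (intro dvd_fact) auto
    then have "d dvd int (fact (nat \<bar>d\<bar>))" using nat_abs_dvd_iff by blast
    then obtain q where "int (fact (nat \<bar>d\<bar>)) = q * d" by (metis dvdE mult.commute)
    then have "x \<in> N (nat \<bar>d\<bar>)" using \<Delta>_mult_eq_0[OF that(2), of q] by (simp add: N_def)
    then show ?thesis using J by (auto simp: N_def)
  qed
  then show ?thesis using that[of "fact J"] by (simp add: fact_ge_1)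
qed

text \<open>Fitting's argument: the kernels of the powers of \<open>\<Delta> d\<close> stabilise at
  some \<open>J\<close>. With \<open>e = J + 1\<close>, an image \<open>(\<Delta> d)^e y\<close>
  killed by \<open>\<Delta> d\<close> has \<open>y\<close> in the kernel of the power
  \<open>e + 1\<close>, hence in that of the power \<open>e\<close>.\<close>

lemma kernel_inter_range:
  obtains e :: nat where "1 \<le> e" "\<And>x. \<Delta> d x = 0 \<Longrightarrow> x \<in> range (\<Delta> d ^^ e) \<Longrightarrow> x = 0"
proof -
  define N where "N i = {x. (\<Delta> d ^^ i) x = 0}" for i
  have mono: "N i \<subseteq> N j" if "i \<le> j" for i j
  proof
    fix x assume "x \<in> N i"
    moreover have "(\<Delta> d ^^ j) x = (\<Delta> d ^^ (j - i)) ((\<Delta> d ^^ i) x)"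
      using that funpow_add[of "j - i" i "\<Delta> d"] by simp
    ultimately show "x \<in> N j" by (simp add: N_def additive.zero[OF \<Delta>_pow_additive])
  qed
  have sub: "subgrp (N i)" for i unfolding N_def by (rule subgrp_kernel[OF \<Delta>_pow_additive])
  have inv: "P a x \<in> N i" if "x \<in> N i" for i x a using that by (simp add: N_def \<Delta>_pow_P)
  obtain J where J: "\<And>i. N i \<subseteq> N J"
    using ascending_chain[of N, OF sub inv mono] by blast
  have "(\<Delta> d ^^ Suc J) y = 0" if "\<Delta> d ((\<Delta> d ^^ Suc J) y) = 0" for y
  proof -
    have "y \<in> N (Suc (Suc J))" using that by (simp add: N_def)
    then have "y \<in> N (Suc J)" using J[of "Suc (Suc J)"] mono[of J "Suc J"] by auto
    then show ?thesis by (simp add: N_def)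
  qed
  then show ?thesis by (intro that[of "Suc J"]) auto
qed

text \<open>Since \<open>\<phi>^(d a) = (1 + \<Delta> d)^a\<close>, the vectors \<open>\<phi>^i (\<Delta> d)^j \<rho>\<close> with \<open>i < d\<close> and \<open>j < e\<close>
  generate \<open>K\<close> modulo the image of \<open>(\<Delta> d)^e\<close>.\<close>

definition E :: "nat \<Rightarrow> nat \<Rightarrow> nat \<Rightarrow> 'k set" where
  "E d e M = comb (R \<times> {..<d} \<times> {..<e}) (\<lambda>(\<rho>, i, j). P (int i) ((\<Delta> (int d) ^^ j) \<rho>)) M"

lemma E_finite: "finite (E d e M)" and E_card: "card (E d e M) \<le> (2 * M + 1) ^ (card R * (d * e))"
  using comb_finite_card[of "R \<times> {..<d} \<times> {..<e}"] fin_R by (auto simp: E_def card_cartesian_product)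

text \<open>The binomial expansion of \<open>(1 + \<Delta> d)^a\<close>, truncated after degree
  \<open>e\<close>; the induction is Pascal's rule applied to the truncated sums.\<close>

lemma P_binomial:
  "P (d * int a) x - (\<Sum>j<Suc e. zmul (int (a choose j)) ((\<Delta> d ^^ j) x)) \<in> range (\<Delta> d ^^ Suc e)"
proof (induction a)
  case 0
  have "(\<Sum>j<Suc e. zmul (int (0 choose j)) ((\<Delta> d ^^ j) x)) = x"
    by (subst sum.lessThan_Suc_shift) simp
  then show ?case by (auto intro!: range_eqI[of _ _ 0] simp: additive.zero[OF \<Delta>_pow_additive] simp del: funpow.simps)
next
  case (Suc a)
  define s where "s a = (\<Sum>j<Suc e. zmul (int (a choose j)) ((\<Delta> d ^^ j) x))" for a
  have \<Delta>s: "\<Delta> d (s a) = (\<Sum>j<Suc e. zmul (int (a choose j)) ((\<Delta> d ^^ Suc j) x))"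
    by (simp add: s_def additive.sum[OF \<Delta>_additive] additive.add[OF \<Delta>_additive] additive_zmul[OF \<Delta>_additive])
  have "s (Suc a) = x + (\<Sum>j<e. zmul (int (a choose Suc j) + int (a choose j)) ((\<Delta> d ^^ Suc j) x))"
    unfolding s_def by (subst sum.lessThan_Suc_shift) (simp add: add.commute)
  also have "\<dots> = (x + (\<Sum>j<e. zmul (int (a choose Suc j)) ((\<Delta> d ^^ Suc j) x)))
      + (\<Sum>j<e. zmul (int (a choose j)) ((\<Delta> d ^^ Suc j) x))"
    by (simp add: zmul_add_left sum.distrib add.assoc del: funpow.simps)
  also have "x + (\<Sum>j<e. zmul (int (a choose Suc j)) ((\<Delta> d ^^ Suc j) x)) = s a"
    unfolding s_def by (subst sum.lessThan_Suc_shift) simp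
  \<comment> \<open>Truncation cuts off the term of index \<open>e\<close> in
    \<open>\<Delta> d (s a)\<close>; it lies in the image of
    \<open>(\<Delta> d)^(e + 1)\<close>.\<close>
  also have "(\<Sum>j<e. zmul (int (a choose j)) ((\<Delta> d ^^ Suc j) x))
      = \<Delta> d (s a) - zmul (int (a choose e)) ((\<Delta> d ^^ Suc e) x)"
    unfolding \<Delta>s by simp
  finally have s: "s (Suc a) = P d (s a) - (\<Delta> d ^^ Suc e) (zmul (int (a choose e)) x)"
    by (simp add: \<Delta>_def[of d "s a"] additive_zmul[OF \<Delta>_pow_additive] del: funpow.simps)
  obtain y where y: "P (d * int a) x - s a = (\<Delta> d ^^ Suc e) y" using Suc unfolding s_def by blast
  have "P (d * int (Suc a)) x - s (Suc a) = P d (P (d * int a) x - s a) + (\<Delta> d ^^ Suc e) (zmul (int (a choose e)) x)"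
    unfolding s by (simp add: P_diff distrib_left P_add del: funpow.simps)
  also have "\<dots> = (\<Delta> d ^^ Suc e) (P d y + zmul (int (a choose e)) x)"
    unfolding y by (simp only: \<Delta>_pow_P additive.add[OF \<Delta>_pow_additive])
  finally show ?case unfolding s_def by blast
qed

text \<open>The number of generators indexing \<open>B n\<close>, times the bound \<open>n\<close>
  on their coefficients, times the bound for one generator once it is expanded in terms of
  \<open>E\<close>.\<close>

definition red :: "nat \<Rightarrow> nat \<Rightarrow> nat \<Rightarrow> nat" where
  "red d e n = card R * (2 * n + 1) * (n * (e * ((d + 1) * n + 1) ^ e))"

text \<open>The shift by \<open>d * n\<close> makes every exponent in \<open>x\<close> non-negative,
  since these are at least \<open>- n\<close> and \<open>d\<close> is positive; then each generator
  is expanded by \<open>P_binomial\<close>.\<close>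

lemma reduce:
  assumes x: "x \<in> B n" and d: "1 \<le> d" and e: "1 \<le> e"
  obtains y where "y \<in> E d e (red d e n)" "P (int (d * n)) x - y \<in> range (\<Delta> (int d) ^^ e)"
proof -
  let ?I = "R \<times> {- int n..int n}"
  let ?A = "range (\<Delta> (int d) ^^ e)"
  have sub: "subgrp ?A" by (rule subgrp_range[OF \<Delta>_pow_additive])
  define v where "v = (\<lambda>(\<rho>, i). P (int (d * n) + i) \<rho>)"
  have "P (int (d * n)) x \<in> comb ?I (\<lambda>p. P (int (d * n)) ((\<lambda>(\<rho>, i). P i \<rho>) p)) n"
    using x unfolding B_def box_def by (rule comb_additive[OF P_additive])
  also have "(\<lambda>p. P (int (d * n)) ((\<lambda>(\<rho>, i). P i \<rho>) p)) = v"
    by (auto simp: v_def P_add)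
  finally obtain c where c: "P (int (d * n)) x = (\<Sum>p\<in>?I. zmul (c p) (v p))" "\<And>p. p \<in> ?I \<Longrightarrow> \<bar>c p\<bar> \<le> int n"
    by (rule combE) blast
  have "\<exists>u. u \<in> E d e (e * ((d + 1) * n + 1) ^ e) \<and> v p - u \<in> ?A" if p: "p \<in> ?I" for p
  proof -
    obtain \<rho> i where \<rho>: "p = (\<rho>, i)" "\<rho> \<in> R" "- int n \<le> i" "i \<le> int n" using p by auto
    have "1 * n \<le> d * n" using d by (rule mult_right_mono) simp
    then have "int n \<le> int (d * n)" by (simp only: mult_1 of_nat_le_iff)
    then have nn: "0 \<le> int (d * n) + i" using \<rho>(3) by linarith
    define t where "t = nat (int (d * n) + i)"
    have t: "int t = int (d * n) + i" "t \<le> (d + 1) * n"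
      using nn \<rho> by (auto simp: t_def nat_le_iff)
    \<comment> \<open>The multiple \<open>d * a\<close> is expanded binomially, and the remainder
      \<open>b\<close> remains as an index of \<open>E\<close>.\<close>
    define a b where "a = t div d" and "b = t mod d"
    have ab: "t = d * a + b" "b < d" "a \<le> (d + 1) * n"
      using d order_trans[OF div_le_dividend[of t d] t(2)] by (simp_all add: a_def b_def)
    obtain e' where e': "e = Suc e'" using e by (cases e) auto
    define u where "u = P (int b) (\<Sum>j<e. zmul (int (a choose j)) ((\<Delta> (int d) ^^ j) \<rho>))"
    have "v p = P (int b) (P (int d * int a) \<rho>)"
    proof -
      have "int (d * n) + i = int b + int d * int a"
        using t(1) unfolding ab(1) by (simp add: add.commute)
      then show ?thesis unfolding v_def \<rho>(1) by (simp only: prod.case flip: P_add)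
    qed
    then have "v p - u = P (int b) (P (int d * int a) \<rho> - (\<Sum>j<e. zmul (int (a choose j)) ((\<Delta> (int d) ^^ j) \<rho>)))"
      by (simp add: u_def P_diff)
    moreover obtain y where "P (int d * int a) \<rho> - (\<Sum>j<e. zmul (int (a choose j)) ((\<Delta> (int d) ^^ j) \<rho>)) = (\<Delta> (int d) ^^ e) y"
      using P_binomial[of "int d" a \<rho> e'] e' by blast
    ultimately have "v p - u = (\<Delta> (int d) ^^ e) (P (int b) y)" by (simp add: \<Delta>_pow_P)
    then have 1: "v p - u \<in> ?A" by blast
    have "u = (\<Sum>j<e. zmul (int (a choose j)) (P (int b) ((\<Delta> (int d) ^^ j) \<rho>)))"
      by (simp add: u_def P_sum additive_zmul[OF P_additive])
    also have "\<dots> \<in> E d e (card {..<e} * ((d + 1) * n + 1) ^ e)"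
      unfolding E_def
    proof (rule comb_sum)
      fix j assume "j \<in> {..<e}"
      then have j: "j < e" by simp
      have mem: "P (int b) ((\<Delta> (int d) ^^ j) \<rho>) \<in> E d e 1"
        using comb_base[of "R \<times> {..<d} \<times> {..<e}" "(\<rho>, b, j)" "\<lambda>(\<rho>, i, j). P (int i) ((\<Delta> (int d) ^^ j) \<rho>)"]
          fin_R \<rho>(2) ab(2) j by (simp add: E_def)
      have *: "zmul (int (a choose j)) (P (int b) ((\<Delta> (int d) ^^ j) \<rho>)) \<in> E d e (a choose j)"
        using comb_zmul[OF mem[unfolded E_def], of "int (a choose j)"] by (simp add: E_def)
      \<comment> \<open>Source of the polynomial growth, as \<open>a\<close> is linear in
        \<open>n\<close>. The base \<open>a + 1\<close> is at least 1, so the exponent can be raised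
        to \<open>e\<close>.\<close>
      have "a choose j \<le> (a + 1) ^ j"
      proof (cases "j \<le> a")
        case True
        have "a choose j \<le> a ^ j" by (rule binomial_le_pow[OF True])
        also have "\<dots> \<le> (a + 1) ^ j" by (rule power_mono) auto
        finally show ?thesis .
      qed (simp add: binomial_eq_0)
      also have "\<dots> \<le> (a + 1) ^ e" using j by (intro power_increasing) auto
      also have "\<dots> \<le> ((d + 1) * n + 1) ^ e" using ab(3) by (intro power_mono) auto
      finally have le: "a choose j \<le> ((d + 1) * n + 1) ^ e" .
      show "zmul (int (a choose j)) (P (int b) ((\<Delta> (int d) ^^ j) \<rho>))
          \<in> comb (R \<times> {..<d} \<times> {..<e}) (\<lambda>(\<rho>, i, j). P (int i) ((\<Delta> (int d) ^^ j) \<rho>)) (((d + 1) * n + 1) ^ e)"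
        by (rule subsetD[OF comb_mono[OF le] *[unfolded E_def]])
    qed simp
    finally show ?thesis using 1 by auto
  qed
  then obtain u where u: "\<And>p. p \<in> ?I \<Longrightarrow> u p \<in> E d e (e * ((d + 1) * n + 1) ^ e)" "\<And>p. p \<in> ?I \<Longrightarrow> v p - u p \<in> ?A"
    by metis
  define y where "y = (\<Sum>p\<in>?I. zmul (c p) (u p))"
  have "y \<in> comb ?I u n" unfolding y_def by (rule combI[OF refl c(2)])
  then have "y \<in> E d e (card ?I * (n * (e * ((d + 1) * n + 1) ^ e)))"
    unfolding E_def by (rule comb_subst) (use fin_R u(1) in \<open>auto simp: E_def\<close>)
  moreover have "card ?I = card R * (2 * n + 1)"
    by (simp add: card_cartesian_product nat_add_distrib nat_mult_distrib)
  ultimately have "y \<in> E d e (red d e n)" by (simp add: red_def)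
  moreover have "P (int (d * n)) x - y = (\<Sum>p\<in>?I. zmul (c p) (v p - u p))"
    unfolding c(1) y_def by (simp add: additive.diff[OF additive_zmul_right] sum_subtractf)
  then have "P (int (d * n)) x - y \<in> ?A"
    using sub u(2) by (auto intro!: subgrp_sum subgrp_zmul)
  ultimately show ?thesis by (rule that)
qed

text \<open>Reduction modulo the image of \<open>(\<Delta> d)^e\<close> is injective on the kernel
  of \<open>\<Delta> d\<close> by the choice of \<open>e\<close>. The exponent in the bound does not
  involve \<open>n\<close>.\<close>

lemma kernel_count:
  fixes d e n :: nat
  assumes d: "1 \<le> d" and e: "1 \<le> e" "\<And>x. \<Delta> (int d) x = 0 \<Longrightarrow> x \<in> range (\<Delta> (int d) ^^ e) \<Longrightarrow> x = 0"
  defines "T \<equiv> {x \<in> B n. \<Delta> (int d) x = 0}"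
  shows "finite T" "card T \<le> (2 * red d e n + 1) ^ (card R * (d * e))"
proof -
  have "\<exists>y. y \<in> E d e (red d e n) \<and> P (int (d * n)) x - y \<in> range (\<Delta> (int d) ^^ e)" if "x \<in> T" for x
    using reduce[OF _ d e(1)] that unfolding T_def by blast
  then obtain h where h: "\<And>x. x \<in> T \<Longrightarrow> h x \<in> E d e (red d e n)"
      "\<And>x. x \<in> T \<Longrightarrow> P (int (d * n)) x - h x \<in> range (\<Delta> (int d) ^^ e)"
    by metis
  have inj: "inj_on h T"
  proof
    fix x y assume xy: "x \<in> T" "y \<in> T" "h x = h y"
    let ?p = "P (int (d * n))"
    have "(?p x - h x) - (?p y - h y) \<in> range (\<Delta> (int d) ^^ e)"
      by (rule subgrp_diff[OF subgrp_range[OF \<Delta>_pow_additive] h(2)[OF xy(1)] h(2)[OF xy(2)]])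
    then have "?p (x - y) \<in> range (\<Delta> (int d) ^^ e)" using xy(3) by (simp add: P_diff)
    moreover have "\<Delta> (int d) (?p (x - y)) = 0"
      using xy by (simp add: T_def \<Delta>_P additive.diff[OF \<Delta>_additive])
    ultimately have "?p (x - y) = 0" by (rule e(2)[rotated])
    then have "P (- int (d * n)) (?p (x - y)) = 0" by (simp del: P_minus)
    then show "x = y" by (simp del: of_nat_mult)
  qed
  have sub: "h ` T \<subseteq> E d e (red d e n)" using h(1) by blast
  show "finite T" using inj_on_finite[OF inj sub E_finite] .
  show "card T \<le> (2 * red d e n + 1) ^ (card R * (d * e))"
    using card_inj_on_le[OF inj sub E_finite] E_card by (rule order_trans)
qed

subsection \<open>Conjugates with a commuting element\<close>

text \<open>The hypothesis \<open>eq\<close> says that \<open>(k, m)\<close> and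
  \<open>(c, \<delta>)\<close> commute. A product of their powers has height
  \<open>e = gcd \<delta> m\<close>; its \<open>K\<close>-component is then replaced by a
  representative from the small set \<open>E e 1\<close>.\<close>

lemma commuting_representative:
  assumes k: "k \<in> B r" and c: "c \<in> B r" and eq: "\<Delta> \<delta> k = \<Delta> m c"
    and \<delta>: "\<delta> \<noteq> 0" "\<bar>\<delta>\<bar> \<le> int r" and m: "\<bar>m\<bar> \<le> int r" and r: "10 \<le> r"
  obtains e x y where "1 \<le> e" "int e \<le> \<bar>\<delta>\<bar>" "x \<in> B (r ^ 6)" "\<Delta> (int e) x = 0"
    "y \<in> E e 1 (red e 1 (r ^ 6))" "conj_class \<phi> (k, m) = conj_class \<phi> (x + Q (m div int e) (int e) y, m)"
proof -
  \<comment> \<open>\<open>z\<close> bounds all integers involved; \<open>\<bar>a\<bar>\<close> may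
    reach \<open>\<bar>m\<bar> + 1\<close>.\<close>
  define z where "z = r + 1"
  obtain a b where ab: "a * \<delta> + b * m = gcd \<delta> m" "\<bar>a\<bar> \<le> \<bar>m\<bar> + 1" "\<bar>b\<bar> \<le> \<bar>\<delta>\<bar>"
    using bezout_bounded[OF \<delta>(1)] by blast
  define e where "e = nat (gcd \<delta> m)"
  have e: "int e = gcd \<delta> m" by (simp add: e_def)
  have e_le: "int e \<le> \<bar>\<delta>\<bar>" unfolding e using \<delta>(1) gcd_le1_int[of "\<bar>\<delta>\<bar>" m] by simp
  have e_ge: "1 \<le> e" using \<delta>(1) e by (simp add: e_def Suc_le_eq)
  have z: "nat \<bar>a\<bar> \<le> z" "nat \<bar>\<delta>\<bar> \<le> z" "nat \<bar>b\<bar> \<le> z" "nat \<bar>m\<bar> \<le> z" "nat \<bar>int e\<bar> \<le> z"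
    using ab \<delta> m e_le by (auto simp: z_def)
  have QD: "Q a d (\<Delta> b' x) = \<Delta> b' (Q a d x)" for a d b' x
    by (simp add: \<Delta>_def additive.diff[OF Q_additive] Q_P)
  \<comment> \<open>\<open>(c', e)\<close> is the product
    \<open>(k, m)^b (c, \<delta>)^a\<close>.\<close>
  define c' where "c' = P (b * m) (Q a \<delta> c) + Q b m k"
  have \<Delta>e: "\<Delta> (int e) k = \<Delta> m c'"
  proof -
    have "\<Delta> (int e) k = P (b * m) (Q a \<delta> (\<Delta> \<delta> k)) + Q b m (\<Delta> m k)"
      by (simp add: e ab(1)[symmetric] \<Delta>_add Q_\<Delta>)
    also have "\<dots> = P (b * m) (\<Delta> m (Q a \<delta> c)) + \<Delta> m (Q b m k)" by (simp only: eq QD)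
    also have "\<dots> = \<Delta> m c'" by (simp add: c'_def additive.add[OF \<Delta>_additive] \<Delta>_P)
    finally show ?thesis .
  qed
  have zz: "11 * (z * z) \<le> z * (z * z)" using r by (intro mult_right_mono) (auto simp: z_def)
  have "nat \<bar>b * m\<bar> \<le> z * z"
    using z by (simp add: abs_mult nat_mult_distrib mult_mono)
  moreover have "z * (r + z * z) \<le> z * z + z * (z * z)" by (simp add: z_def algebra_simps)
  ultimately have bnd: "z * (r + z * z) + z * z + nat \<bar>b * m\<bar> + (z * (r + z * z) + z * z) \<le> 3 * (z * (z * z))"
    using zz by linarith
  have "P (b * m) (Q a \<delta> c) \<in> B (z * (r + z * z) + z * z + nat \<bar>b * m\<bar>)"
    by (rule B_P[OF B_Q[OF c z(1,2)]])
  then have "c' \<in> B (z * (r + z * z) + z * z + nat \<bar>b * m\<bar> + (z * (r + z * z) + z * z))"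
    unfolding c'_def by (rule B_add[OF _ B_Q[OF k z(3,4)]])
  then have c'B: "c' \<in> B (3 * (z * (z * z)))" using bnd by (rule B_mono)
  \<comment> \<open>As \<open>z \<le> 2 * r\<close> and \<open>64 \<le> r ^ 2\<close>, the quartic
    bounds in \<open>z\<close> fit below \<open>r ^ 6\<close>; terms of lower degree are absorbed
    through \<open>11 \<le> z\<close>.\<close>
  have "z ^ 4 \<le> (2 * r) ^ 4" using r by (intro power_mono) (auto simp: z_def)
  then have "4 * z ^ 4 \<le> 64 * r ^ 4" by (simp add: power_mult_distrib)
  also have "\<dots> \<le> r ^ 2 * r ^ 4"
    using power_mono[OF r, of 2] by (intro mult_right_mono) auto
  also have "\<dots> = r ^ 6" by (simp flip: power_add)
  finally have z4: "4 * z ^ 4 \<le> r ^ 6" .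
  have zz': "11 * (z * (z * z)) \<le> z * (z * (z * z))" using r by (intro mult_right_mono) (auto simp: z_def)
  have z4': "z ^ 4 = z * (z * (z * z))" by (simp add: numeral_eq_Suc)
  have "r \<le> z * z" by (simp add: z_def)
  have "3 * (z * (z * z)) \<le> r ^ 6" using z4 zz' z4' by linarith
  with c'B have c'B6: "c' \<in> B (r ^ 6)" by (rule B_mono)
  define q where "q = m div int e"
  have q: "m = q * int e" unfolding q_def e by simp
  have "nat \<bar>q\<bar> \<le> z"
  proof -
    have "\<bar>q\<bar> * 1 \<le> \<bar>q\<bar> * int e" using e_ge by (intro mult_left_mono) auto
    also have "\<dots> = \<bar>m\<bar>" by (simp add: q abs_mult)
    finally show ?thesis using m by (simp add: z_def)
  qed
  then have "Q q (int e) c' \<in> B (z * (3 * (z * (z * z)) + z * z) + z * z)"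
    using z(5) by (rule B_Q[OF c'B])
  then have xB: "k - Q q (int e) c' \<in> B (r + (z * (3 * (z * (z * z)) + z * z) + z * z))"
    by (rule B_diff[OF k])
  \<comment> \<open>Chosen so that \<open>(k, m) = (x, 0) (c', e)^q\<close>.\<close>
  define x where "x = k - Q q (int e) c'"
  have "z * (3 * (z * (z * z)) + z * z) = 3 * (z * (z * (z * z))) + z * (z * z)" by (simp add: algebra_simps)
  then have "r + (z * (3 * (z * (z * z)) + z * z) + z * z) \<le> r ^ 6"
    using z4 zz' z4' zz \<open>r \<le> z * z\<close> by linarith
  with xB have x: "x \<in> B (r ^ 6)" unfolding x_def by (rule B_mono)
  have x0: "\<Delta> (int e) x = 0"
    unfolding x_def by (simp add: additive.diff[OF \<Delta>_additive] \<Delta>_Q \<Delta>e flip: q)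
  obtain y where y: "y \<in> E e 1 (red e 1 (r ^ 6))" "P (int (e * r ^ 6)) c' - y \<in> range (\<Delta> (int e) ^^ 1)"
    using reduce[OF c'B6 e_ge order_refl] by blast
  then obtain w where w: "P (int (e * r ^ 6)) c' - y = \<Delta> (int e) w" by auto
  \<comment> \<open>The shift introduced by \<open>reduce\<close> is by a multiple of
    \<open>e\<close>, hence trivial modulo the image of \<open>\<Delta> e\<close>; so
    \<open>c'\<close> itself is congruent to \<open>y\<close>.\<close>
  have "int (e * r ^ 6) = int (r ^ 6) * int e" by simp
  then have "P (int (e * r ^ 6)) c' - c' = \<Delta> (int e) (Q (int (r ^ 6)) (int e) c')"
    unfolding \<Delta>_Q by (simp only: \<Delta>_def)
  then have "c' - y = \<Delta> (int e) (w - Q (int (r ^ 6)) (int e) c')"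
    using w by (simp add: additive.diff[OF \<Delta>_additive] algebra_simps)
  then obtain h where "c' - y = \<Delta> (int e) h" by blast
  \<comment> \<open>\<open>Q\<close> turns \<open>\<Delta> e h\<close> into
    \<open>\<Delta> m h\<close>, so exchanging \<open>c'\<close> for \<open>y\<close> amounts to a
    conjugation.\<close>
  then have "Q q (int e) c' - Q q (int e) y = \<Delta> m h"
    by (simp add: Q_\<Delta> flip: additive.diff[OF Q_additive] q)
  then have "x + Q q (int e) y = k - \<Delta> m h" by (simp add: x_def algebra_simps)
  then have "conj_class \<phi> (k, m) = conj_class \<phi> (x + Q q (int e) y, m)"
    by (simp add: conj_class_translate)
  then show ?thesis using that e_ge e_le x x0 y(1) unfolding q_def by blast
qed

text \<open>The values of \<open>u\<close> and \<open>v\<close> commute, so that of \<open>v\<close>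
  commutes with that of \<open>u @ v\<close>; compare the \<open>K\<close>-components.\<close>

lemma cyclic_coincidence:
  assumes "word_eval \<phi> (v @ u) = word_eval \<phi> (u @ v)"
    and "word_eval \<phi> v = (c, \<delta>)" "word_eval \<phi> (u @ v) = (k, m)"
  shows "\<Delta> \<delta> k = \<Delta> m c"
proof -
  let ?p = "word_eval \<phi> v" and ?q = "word_eval \<phi> u"
  have comm: "sd_mult \<phi> ?p ?q = sd_mult \<phi> ?q ?p" using assms(1) by (simp add: word_eval_append)
  then have "sd_mult \<phi> ?p (sd_mult \<phi> ?q ?p) = sd_mult \<phi> (sd_mult \<phi> ?q ?p) ?p"
    by (simp flip: sd_mult_assoc)
  then have "sd_mult \<phi> (c, \<delta>) (k, m) = sd_mult \<phi> (k, m) (c, \<delta>)"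
    using assms(2,3) by (simp add: word_eval_append)
  then show ?thesis by (simp add: sd_mult_def \<Delta>_def algebra_simps)
qed

text \<open>Heights change by at most 1 per letter, so all values between the extremes occur. If
  these lie more than \<open>A\<close> apart, the \<open>A + 1\<close> lowest heights give rotations
  with at most \<open>A\<close> values, and two must agree.\<close>

lemma heights_or_coincidence:
  assumes ws: "set ws \<subseteq> S"
    and X: "finite X" "card X \<le> A" "\<And>i. i \<le> length ws \<Longrightarrow> word_eval \<phi> (drop i ws @ take i ws) \<in> X"
  obtains (narrow) a where "\<And>i. i \<le> length ws \<Longrightarrow> snd (word_eval \<phi> (take i ws)) \<in> {a..a + int A}"
  | (coincidence) i j where "i < j" "j \<le> length ws"
      "word_eval \<phi> (drop i ws @ take i ws) = word_eval \<phi> (drop j ws @ take j ws)"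
      "snd (word_eval \<phi> (take i ws)) \<noteq> snd (word_eval \<phi> (take j ws))"
      "\<bar>snd (word_eval \<phi> (take i ws)) - snd (word_eval \<phi> (take j ws))\<bar> \<le> int A"
proof -
  define h where "h i = snd (word_eval \<phi> (take i ws))" for i
  define G where "G i = word_eval \<phi> (drop i ws @ take i ws)" for i
  let ?H = "h ` {..length ws}"
  define lo hi where "lo = Min ?H" and "hi = Max ?H"
  have bnd: "lo \<le> h i" "h i \<le> hi" if "i \<le> length ws" for i
    using that by (auto simp: lo_def hi_def)
  have "lo \<in> ?H" "hi \<in> ?H" unfolding lo_def hi_def by (auto intro!: Min_in Max_in)
  then obtain i0 j0 where ij0: "i0 \<le> length ws" "h i0 = lo" "j0 \<le> length ws" "h j0 = hi" by auto
  have step: "\<bar>h (Suc i) - h i\<bar> \<le> 1" if "i < length ws" for i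
  proof -
    have "ws ! i \<in> S" using ws that by (meson nth_mem subsetD)
    then have "\<bar>snd (ws ! i)\<bar> \<le> 1" by auto
    then show ?thesis
      using that by (simp add: h_def take_Suc_conv_app_nth snd_word_eval_append)
  qed
  have attained: "\<exists>i\<le>length ws. h i = v" if "lo \<le> v" "v \<le> hi" for v
  proof (cases "i0 \<le> j0")
    case True
    have "\<exists>i. i0 \<le> i \<and> i \<le> j0 \<and> h i = v"
      using True step ij0 that by (intro nat_intermed_int_val) auto
    then show ?thesis using ij0(3) order_trans by blast
  next
    case False
    \<comment> \<open>If the maximum is met before the minimum, the discrete intermediate value
      theorem is applied to \<open>- h\<close>.\<close>
    have "\<bar>- h (Suc i) - - h i\<bar> \<le> 1" if "i < length ws" for i
      using step[OF that] by simp
    then have "\<exists>i. j0 \<le> i \<and> i \<le> i0 \<and> - h i = - v"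
      using False ij0 that by (intro nat_intermed_int_val) auto
    then show ?thesis using ij0(1) order_trans by auto
  qed
  show ?thesis
  proof (cases "hi \<le> lo + int A")
    case True
    then show ?thesis using bnd by (intro narrow[of lo]) (fastforce simp: h_def)
  next
    case False
    let ?V = "{lo..lo + int A}"
    have "\<forall>v\<in>?V. \<exists>i\<le>length ws. h i = v" using attained False by auto
    then obtain \<iota> where \<iota>: "\<And>v. v \<in> ?V \<Longrightarrow> \<iota> v \<le> length ws \<and> h (\<iota> v) = v" by metis
    have "(\<lambda>v. G (\<iota> v)) ` ?V \<subseteq> X" using \<iota> X(3) by (auto simp: G_def)
    then have "card ((\<lambda>v. G (\<iota> v)) ` ?V) \<le> A" using X(1,2) card_mono order_trans by blast
    then have "card ((\<lambda>v. G (\<iota> v)) ` ?V) < card ?V" by simp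
    then have "\<not> inj_on (\<lambda>v. G (\<iota> v)) ?V" by (rule pigeonhole)
    then obtain v w where vw: "v \<in> ?V" "w \<in> ?V" "v \<noteq> w" "G (\<iota> v) = G (\<iota> w)" by (auto simp: inj_on_def)
    have "\<bar>v - w\<bar> \<le> int A" using vw by auto
    have *: thesis if "v \<in> ?V" "w \<in> ?V" "v \<noteq> w" "G (\<iota> v) = G (\<iota> w)" "\<iota> v < \<iota> w" for v w
      using that \<iota>[of v] \<iota>[of w] by (intro coincidence[of "\<iota> v" "\<iota> w"]) (auto simp: G_def h_def)
    have "\<iota> v \<noteq> \<iota> w" using \<iota> vw by metis
    then show ?thesis using *[of v w] *[of w v] vw by (metis linorder_neqE_nat)
  qed
qed

section \<open>Geodesic words, representatives of the classes in \<open>F\<close>, and their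
  number\<close>

lemma word_len_le: "set ws \<subseteq> S \<Longrightarrow> word_len \<phi> S (word_eval \<phi> ws) \<le> length ws"
  unfolding word_len_def by (rule Least_le) blast

lemma geodesic:
  obtains ws where "length ws = word_len \<phi> S g" "set ws \<subseteq> S" "word_eval \<phi> ws = g"
proof -
  have "\<exists>n ws. length ws = n \<and> set ws \<subseteq> S \<and> word_eval \<phi> ws = g" using gen by blast
  from LeastI_ex[OF this] show ?thesis using that unfolding word_len_def by blast
qed

text \<open>Makes the cardinalities in \<open>F\<close> genuine counts: \<open>card\<close> of an
  infinite set would be 0.\<close>

lemma finite_sphere: "finite (sphere \<phi> S r)"
proof (rule finite_subset)
  show "sphere \<phi> S r \<subseteq> word_eval \<phi> ` {ws. set ws \<subseteq> S \<and> length ws = r}"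
  proof
    fix g assume "g \<in> sphere \<phi> S r"
    then show "g \<in> word_eval \<phi> ` {ws. set ws \<subseteq> S \<and> length ws = r}"
      using geodesic[of g] unfolding sphere_def by (metis (mono_tags, lifting) image_eqI mem_Collect_eq)
  qed
  show "finite (word_eval \<phi> ` {ws. set ws \<subseteq> S \<and> length ws = r})"
    using fin_R by (intro finite_imageI finite_lists_length_eq) auto
qed

lemma word_eval_rotate_conj: "word_eval \<phi> (v @ u) \<in> conj_class \<phi> (word_eval \<phi> (u @ v))"
proof -
  have "word_eval \<phi> (v @ u) = sd_mult \<phi> (sd_mult \<phi> (word_eval \<phi> v) (word_eval \<phi> (u @ v))) (sd_inv \<phi> (word_eval \<phi> v))"
    by (simp add: word_eval_append sd_mult_assoc)
  then show ?thesis unfolding conj_class_def by blast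
qed

text \<open>For exponent 1 only \<open>j = 0\<close> occurs, leaving the generators
  \<open>P i \<rho>\<close> with \<open>0 \<le> i < d\<close>. The larger box is independent of
  \<open>d\<close>.\<close>

lemma E_subset_box:
  assumes "d \<le> A"
  shows "E d 1 M \<subseteq> box {0..int A} M"
proof
  fix x assume "x \<in> E d 1 M"
  then show "x \<in> box {0..int A} M"
    unfolding E_def box_def
    by (rule comb_reindex[where s = "\<lambda>(\<rho>, i, j). (\<rho>, int i)"]) (use fin_R assms in \<open>auto simp: inj_on_def\<close>)
qed

lemma box_finite: "finite (box {0..int A} n)" and box_card: "card (box {0..int A} n) \<le> (2 * n + 1) ^ (card R * (A + 1))"
  using comb_finite_card[of "R \<times> {0..int A}"] fin_R by (auto simp: box_def card_cartesian_product nat_add_distrib)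

text \<open>The integer \<open>A\<close> stands for the floor of \<open>f r\<close>.\<close>

definition F :: "nat \<Rightarrow> nat \<Rightarrow> ('k \<times> int) set" where
  "F r A = {g \<in> sphere' \<phi> S r. card (conj_class \<phi> g \<inter> sphere \<phi> S r) \<le> A}"

lemma F_cases:
  assumes g: "g \<in> F r A" and r: "10 \<le> r"
  obtains (narrow) y m where "\<bar>m\<bar> \<le> int r" "y \<in> box {0..int A} r" "conj_class \<phi> g = conj_class \<phi> (y, m)"
  | (commuting) e x y m where "\<bar>m\<bar> \<le> int r" "1 \<le> e" "e \<le> r" "x \<in> B (r ^ 6)" "\<Delta> (int e) x = 0"
      "y \<in> box {0..int A} (red r 1 (r ^ 6))"
      "conj_class \<phi> g = conj_class \<phi> (x + Q (m div int e) (int e) y, m)"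
proof -
  have sph: "word_len \<phi> S g = r" and min: "\<And>h. h \<in> conj_class \<phi> g \<Longrightarrow> r \<le> word_len \<phi> S h"
    and cA: "card (conj_class \<phi> g \<inter> sphere \<phi> S r) \<le> A"
    using g by (auto simp: F_def sphere'_def sphere_def)
  obtain ws where ws: "length ws = r" "set ws \<subseteq> S" "word_eval \<phi> ws = g" using geodesic[of g] sph by metis
  define m where "m = snd g"
  have m: "\<bar>m\<bar> \<le> int r" using snd_word_le[OF ws(2)] ws by (simp add: m_def)
  have cyc_conj: "word_eval \<phi> (drop i ws @ take i ws) \<in> conj_class \<phi> g" for i
    using word_eval_rotate_conj[of "drop i ws" "take i ws"] ws(3) by simp
  have cyc: "word_eval \<phi> (drop i ws @ take i ws) \<in> conj_class \<phi> g \<inter> sphere \<phi> S r" for i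
  proof -
    have "set (drop i ws @ take i ws) = set ws" by (metis append_take_drop_id set_append sup_commute)
    then have "word_len \<phi> S (word_eval \<phi> (drop i ws @ take i ws)) \<le> r"
      using word_len_le[of "drop i ws @ take i ws"] ws by simp
    then show ?thesis using min[OF cyc_conj[of i]] cyc_conj[of i] by (simp add: sphere_def)
  qed
  have "finite (conj_class \<phi> g \<inter> sphere \<phi> S r)" using finite_sphere by blast
  from ws(2) this cA cyc show ?thesis
  proof (cases rule: heights_or_coincidence)
    case (narrow a)
    have "fst (word_eval \<phi> ws) \<in> box {a..a + int A} (length ws)"
      by (rule word_box[OF ws(2) narrow]) auto
    \<comment> \<open>Conjugation by a power of \<open>t\<close> moves the window of heights to
      \<open>{0..A}\<close>.\<close>
    then have "P (- a) (fst g) \<in> box {0..int A} r"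
      unfolding ws(1,3) by (rule box_P) auto
    moreover have "conj_class \<phi> g = conj_class \<phi> (P (- a) (fst g), m)"
      by (simp add: conj_class_shift m_def)
    ultimately show ?thesis using that(1) m by blast
  next
    case (coincidence i j)
    \<comment> \<open>The cyclic word is cut at both positions: \<open>v\<close> is the stretch from
      \<open>i\<close> to \<open>j\<close>, and \<open>u\<close> is the rest.\<close>
    define u where "u = drop j ws @ take i ws"
    define v where "v = take (j - i) (drop i ws)"
    have tj: "take j ws = take i ws @ v"
      using coincidence(1) by (simp add: v_def flip: take_add)
    have di: "drop i ws = v @ drop j ws"
      using coincidence(1) append_take_drop_id[of "j - i" "drop i ws"] by (simp add: v_def)
    have vu: "v @ u = drop i ws @ take i ws" and uv: "u @ v = drop j ws @ take j ws"
      by (simp_all add: u_def tj di)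
    obtain c \<delta> where c: "word_eval \<phi> v = (c, \<delta>)" by fastforce
    obtain k m' where k: "word_eval \<phi> (u @ v) = (k, m')" by fastforce
    have "m' = m"
    proof -
      have "m' = snd (word_eval \<phi> (take j ws @ drop j ws))"
        using k unfolding uv snd_word_eval_append by (metis add.commute snd_conv snd_word_eval_append)
      then show ?thesis using ws(3) by (simp add: m_def)
    qed
    have \<delta>: "snd (word_eval \<phi> (take j ws)) = snd (word_eval \<phi> (take i ws)) + \<delta>"
      unfolding tj snd_word_eval_append by (simp add: c)
    have "set (u @ v) \<subseteq> S"
      using ws(2) unfolding uv by (auto dest!: in_set_takeD in_set_dropD)
    have len: "length (u @ v) = r" unfolding uv using ws(1) by simp
    have kB: "k \<in> B r" using word_B[OF \<open>set (u @ v) \<subseteq> S\<close>] k len by simp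
    have "set v \<subseteq> S" "length v \<le> r" using \<open>set (u @ v) \<subseteq> S\<close> len by auto
    then have cB: "c \<in> B r" and \<delta>r: "\<bar>\<delta>\<bar> \<le> int r"
      using word_B[of v] snd_word_le[of v] c by (auto intro: B_mono)
    have "\<Delta> \<delta> k = \<Delta> m' c"
      by (rule cyclic_coincidence[OF _ c k]) (use coincidence(3) vu uv in simp)
    then have eq: "\<Delta> \<delta> k = \<Delta> m c" using \<open>m' = m\<close> by simp
    have \<delta>A: "\<delta> \<noteq> 0" "\<bar>\<delta>\<bar> \<le> int A" using coincidence(4,5) \<delta> by auto
    obtain e x y where e: "1 \<le> e" "int e \<le> \<bar>\<delta>\<bar>" and x: "x \<in> B (r ^ 6)" "\<Delta> (int e) x = 0"
      and y: "y \<in> E e 1 (red e 1 (r ^ 6))"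
      and conj: "conj_class \<phi> (k, m) = conj_class \<phi> (x + Q (m div int e) (int e) y, m)"
      using commuting_representative[OF kB cB eq \<delta>A(1) \<delta>r m r] by blast
    have er: "e \<le> r" "e \<le> A" using e(2) \<delta>r \<delta>A(2) by auto
    have "y \<in> box {0..int A} (red e 1 (r ^ 6))" using E_subset_box[OF er(2)] y by blast
    \<comment> \<open>\<open>e\<close> varies with \<open>g\<close>; the bound is made uniform
      through \<open>e \<le> r\<close>.\<close>
    moreover have "red e 1 (r ^ 6) \<le> red r 1 (r ^ 6)"
      unfolding red_def using er(1) by (intro mult_mono power_mono add_mono order_refl) auto
    ultimately have "y \<in> box {0..int A} (red r 1 (r ^ 6))"
      by (rule box_mono[OF _ order_refl finite_atLeastAtMost_int])
    moreover have "conj_class \<phi> g = conj_class \<phi> (k, m)"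
      using conj_class_eq[OF cyc_conj[of j]] k \<open>m' = m\<close> uv by simp
    ultimately show ?thesis using that(2) m e(1) er(1) x conj by metis
  qed
qed

text \<open>The classes are images of the parameter tuples in \<open>C1\<close> and
  \<open>C2\<close>, one set for each case of \<open>F_cases\<close>.\<close>

lemma num_classes_F:
  assumes r: "10 \<le> r"
    and D: "1 \<le> D" "\<And>d x. d \<noteq> 0 \<Longrightarrow> \<Delta> d x = 0 \<Longrightarrow> \<Delta> (int D) x = 0"
    and e: "1 \<le> e" "\<And>x. \<Delta> (int D) x = 0 \<Longrightarrow> x \<in> range (\<Delta> (int D) ^^ e) \<Longrightarrow> x = 0"
  shows "num_classes \<phi> (F r A) \<le> (2 * r + 1) * (2 * r + 1) ^ (card R * (A + 1))
    + (2 * r + 1) * (r * ((2 * red D e (r ^ 6) + 1) ^ (card R * (D * e))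
        * (2 * red r 1 (r ^ 6) + 1) ^ (card R * (A + 1))))"
proof -
  define T where "T = {x \<in> B (r ^ 6). \<Delta> (int D) x = 0}"
  have T: "finite T" "card T \<le> (2 * red D e (r ^ 6) + 1) ^ (card R * (D * e))"
    unfolding T_def using kernel_count[OF D(1) e] by blast+
  define M where "M = {- int r..int r}"
  have M: "finite M" "card M = 2 * r + 1" by (auto simp: M_def)
  define C1 where "C1 = M \<times> box {0..int A} r"
  define C2 where "C2 = M \<times> {1..r} \<times> T \<times> box {0..int A} (red r 1 (r ^ 6))"
  define H1 where "H1 = (\<lambda>(m, y). conj_class \<phi> (y, m))"
  define H2 where "H2 = (\<lambda>(m, e, x, y). conj_class \<phi> (x + Q (m div int e) (int e) y, m))"
  have fin: "finite C1" "finite C2" using M T box_finite by (auto simp: C1_def C2_def)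
  have "conj_class \<phi> ` F r A \<subseteq> H1 ` C1 \<union> H2 ` C2"
  proof
    fix X assume "X \<in> conj_class \<phi> ` F r A"
    then obtain g where g: "g \<in> F r A" "X = conj_class \<phi> g" by blast
    from g(1) r show "X \<in> H1 ` C1 \<union> H2 ` C2"
    proof (cases rule: F_cases)
      case (narrow y m)
      then have "(m, y) \<in> C1" by (auto simp: C1_def M_def)
      moreover have "X = H1 (m, y)" using narrow g by (simp add: H1_def)
      ultimately show ?thesis by blast
    next
      case (commuting e x y m)
      \<comment> \<open>The period \<open>e\<close> depends on the class, but the common period
        \<open>D\<close> puts every \<open>x\<close> into one kernel, already counted.\<close>
      then have "x \<in> T" using D(2)[of "int e" x] by (simp add: T_def)
      with commuting have "(m, e, x, y) \<in> C2" by (auto simp: C2_def M_def)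
      moreover have "X = H2 (m, e, x, y)" using commuting g by (simp add: H2_def)
      ultimately show ?thesis by blast
    qed
  qed
  then have "num_classes \<phi> (F r A) \<le> card (H1 ` C1 \<union> H2 ` C2)"
    unfolding num_classes_def using fin by (intro card_mono) auto
  also have "\<dots> \<le> card C1 + card C2"
    using card_Un_le[of "H1 ` C1" "H2 ` C2"] card_image_le[OF fin(1), of H1] card_image_le[OF fin(2), of H2] by linarith
  also have "card C1 \<le> (2 * r + 1) * (2 * r + 1) ^ (card R * (A + 1))"
    unfolding C1_def card_cartesian_product M(2) by (intro mult_left_mono box_card) auto
  also have "card C2 \<le> (2 * r + 1) * (r * ((2 * red D e (r ^ 6) + 1) ^ (card R * (D * e))
        * (2 * red r 1 (r ^ 6) + 1) ^ (card R * (A + 1))))"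
    unfolding C2_def card_cartesian_product M(2) by (intro mult_mono box_card T(2)) auto
  finally show ?thesis by simp
qed

lemma num_classes_F_growth:
  "\<exists>K r0. \<forall>r\<ge>r0. \<forall>A. num_classes \<phi> (F r A) \<le> r ^ (K + 24 * card R * (A + 1))"
proof -
  obtain D where D: "1 \<le> D" "\<And>d x. d \<noteq> 0 \<Longrightarrow> \<Delta> d x = 0 \<Longrightarrow> \<Delta> (int D) x = 0"
    using uniform_period by blast
  obtain e where e: "1 \<le> e" "\<And>x. \<Delta> (int D) x = 0 \<Longrightarrow> x \<in> range (\<Delta> (int D) ^^ e) \<Longrightarrow> x = 0"
    using kernel_inter_range[of "int D"] by blast
  let ?N = "card R"
  \<comment> \<open>Exponent of the factor counting the periodic \<open>x\<close>, free of
    \<open>r\<close> and \<open>A\<close>.\<close>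
  define L where "L = (16 + 8 * e) * (?N * (D * e))"
  have "num_classes \<phi> (F r A) \<le> r ^ (4 + L + 24 * ?N * (A + 1))" if r: "10 + ?N + D + e \<le> r" for r A
  proof -
    have r10: "10 \<le> r" "1 \<le> r" using r by auto
    have step: "3 * r ^ n \<le> r ^ Suc n" for n using r10 by simp
    have pos: "1 \<le> r ^ n" for n using r10 by simp
    have double: "2 * x + 1 \<le> r ^ Suc n" if "x \<le> r ^ n" for x n
      using that step[of n] pos[of n] by linarith
    have 0: "2 * r + 1 \<le> r ^ 2" using double[of r 1] by (simp add: numeral_2_eq_2)
    have 1: "2 * r ^ 6 + 1 \<le> r ^ 7" using double[of "r ^ 6" 6] by simp
    \<comment> \<open>The factors of \<open>red\<close> contribute \<open>r\<close>,
      \<open>r ^ 7\<close>, \<open>r ^ 6\<close>, \<open>r\<close> and \<open>r ^ (8 * e')\<close>.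
      For \<open>e' = 1\<close> the total exponent is 23, and \<open>double\<close> adds one, whence
      the 24.\<close>
    have red_le: "red d e' (r ^ 6) \<le> r ^ (15 + 8 * e')" if "d \<le> r" "e' \<le> r" for d e'
    proof -
      have "(d + 1) * r ^ 6 + 1 \<le> (d + 2) * r ^ 6" using pos[of 6] by (simp add: algebra_simps)
      also have "\<dots> \<le> (r * r) * r ^ 6"
      proof (intro mult_right_mono)
        have "10 * r \<le> r * r" using r10 by (intro mult_right_mono) auto
        then show "d + 2 \<le> r * r" using that r10 by linarith
      qed simp
      also have "\<dots> = r ^ 8" by (simp add: numeral_eq_Suc)
      finally have "((d + 1) * r ^ 6 + 1) ^ e' \<le> (r ^ 8) ^ e'" by (intro power_mono) auto
      moreover have "?N \<le> r" using r by simp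
      ultimately have "red d e' (r ^ 6) \<le> r * r ^ 7 * (r ^ 6 * (r * (r ^ 8) ^ e'))"
        unfolding red_def using 1 that by (intro mult_mono) auto
      also have "\<dots> = r ^ (15 + 8 * e')" by (simp add: power_add power_mult power_mult_distrib numeral_eq_Suc)
      finally show ?thesis .
    qed
    have 2: "2 * red D e (r ^ 6) + 1 \<le> r ^ (16 + 8 * e)"
      using double[OF red_le[of D e]] r by simp
    have 3: "2 * red r 1 (r ^ 6) + 1 \<le> r ^ 24"
      using double[OF red_le[of r 1]] r by simp
    let ?a = "?N * (A + 1)"
    have "num_classes \<phi> (F r A) \<le> (2 * r + 1) * (2 * r + 1) ^ ?a
        + (2 * r + 1) * (r * ((2 * red D e (r ^ 6) + 1) ^ (?N * (D * e)) * (2 * red r 1 (r ^ 6) + 1) ^ ?a))"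
      by (rule num_classes_F[OF r10(1) D e])
    also have "\<dots> \<le> r ^ 2 * (r ^ 2) ^ ?a + r ^ 2 * (r * ((r ^ (16 + 8 * e)) ^ (?N * (D * e)) * (r ^ 24) ^ ?a))"
      by (intro add_mono mult_mono power_mono 0 2 3) auto
    also have "\<dots> = r ^ (2 + 2 * ?a) + r ^ (3 + L + 24 * ?a)"
      by (simp add: L_def power_add power_mult power_mult_distrib numeral_3_eq_3 numeral_2_eq_2)
    also have "\<dots> \<le> r ^ (3 + L + 24 * ?a) + r ^ (3 + L + 24 * ?a)"
      using r10 by (intro add_right_mono power_increasing) auto
    also have "\<dots> \<le> r ^ Suc (3 + L + 24 * ?a)" using step[of "3 + L + 24 * ?a"] by linarith
    also have "Suc (3 + L + 24 * ?a) = 4 + L + 24 * ?N * (A + 1)" by simp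
    finally show ?thesis .
  qed
  then show ?thesis by blast
qed

end

theorem theorem4p3:
  fixes \<phi> :: "'k::ab_group_add \<Rightarrow> 'k"
    and R :: "'k set"
    and f :: "nat \<Rightarrow> real"
  assumes phi_bij: "bij \<phi>"
    and phi_add: "\<And>a b. \<phi> (a + b) = \<phi> a + \<phi> b"
    and R_fin: "finite R"
    and R_sym: "\<And>r. r \<in> R \<Longrightarrow> - r \<in> R"
    and S_gen: "\<And>g. \<exists>ws. set ws \<subseteq> (\<lambda>r. (r, 0)) ` R \<union> {(0, 1), (0, -1)}
                          \<and> word_eval \<phi> ws = g"
    and f_nonneg: "\<And>r. 0 \<le> f r"
    and f_lim: "filterlim f at_top sequentially"
  shows "\<exists>C::real. \<forall>\<^sub>F r in sequentially.
           real (num_classes \<phi>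
              {g \<in> sphere' \<phi> ((\<lambda>r. (r, 0)) ` R \<union> {(0, 1), (0, -1)}) r.
                 real (card (conj_class \<phi> g \<inter> sphere \<phi> ((\<lambda>r. (r, 0)) ` R \<union> {(0, 1), (0, -1)}) r)) \<le> f r})
           \<le> real r powr (C * f r)"
proof -
  interpret generated \<phi> R
    using phi_bij phi_add R_fin S_gen by unfold_locales
  obtain K r0 where K: "\<And>r A. r0 \<le> r \<Longrightarrow> num_classes \<phi> (F r A) \<le> r ^ (K + 24 * card R * (A + 1))"
    using num_classes_F_growth by blast
  \<comment> \<open>Once \<open>f r \<ge> 1\<close>, both \<open>A + 1 \<le> 2 * f r\<close> and
    \<open>K \<le> K * f r\<close> hold, which doubles 24 to 48.\<close>
  define C where "C = real (K + 48 * card R)"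
  have "\<forall>\<^sub>F r in sequentially. 1 \<le> f r" using f_lim by (simp add: filterlim_at_top)
  moreover have "\<forall>\<^sub>F r in sequentially. max r0 1 \<le> r" by (rule eventually_ge_at_top)
  ultimately have "\<forall>\<^sub>F r in sequentially.
      real (num_classes \<phi> {g \<in> sphere' \<phi> S r. real (card (conj_class \<phi> g \<inter> sphere \<phi> S r)) \<le> f r})
        \<le> real r powr (C * f r)"
  proof eventually_elim
    case (elim r)
    define A where "A = nat \<lfloor>f r\<rfloor>"
    have A: "real A \<le> f r" using f_nonneg[of r] by (simp add: A_def)
    have "real n \<le> f r \<longleftrightarrow> n \<le> A" for n
      using A unfolding A_def by (meson le_nat_floor of_nat_le_iff order_trans)
    then have "real (num_classes \<phi> {g \<in> sphere' \<phi> S r. real (card (conj_class \<phi> g \<inter> sphere \<phi> S r)) \<le> f r})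
        = real (num_classes \<phi> (F r A))"
      by (simp add: F_def)
    also have "\<dots> \<le> real (r ^ (K + 24 * card R * (A + 1)))"
      using K elim by (simp only: of_nat_le_iff max.bounded_iff)
    also have "\<dots> = real r powr real (K + 24 * card R * (A + 1))"
      by (subst powr_realpow) (use elim in simp_all)
    also have "\<dots> \<le> real r powr (C * f r)"
    proof (rule powr_mono)
      have "real (24 * card R) * (real A + 1) \<le> real (24 * card R) * (2 * f r)"
        using A elim by (intro mult_left_mono) auto
      moreover have "real K * 1 \<le> real K * f r" using elim by (intro mult_left_mono) auto
      ultimately show "real (K + 24 * card R * (A + 1)) \<le> C * f r" by (simp add: C_def algebra_simps)
    qed (use elim in simp)
    finally show ?case .
  qed
  then show ?thesis by blast
qed

end
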